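(* Let $u=(u_1,\ldots,u_m)\in S^{2m-1}$, let $f$ be a non-constant entire function in $\mathbb{C}^m$ and let $k, n$ be positive integers such that $n\geq k+2$ and $\partial_u^k(f^n)\not\equiv 0$. If $f^n$ and $\partial_u^k(f^n)$ share $1$ IM, then $f\equiv c\,\partial_u(f)$, where $c\in\mathbb{C}\setminus\{0\}$ is such that $(c/n)^k=1$. In particular, if $u_j=1$ and $u_i=0$ for $i\neq j$, then \[f(z)=e^{cz_j+\alpha(z)},\] where $\alpha(z)=\alpha(z_1,\ldots,z_{j-1},z_{j+1},\ldots,z_m)$ is a non-constant entire function in $\mathbb{C}^{m-1}$ and $(c/n)^k=1$.
   Context: $S^{2m-1}=\{(u_1,\ldots,u_m)\in\mathbb{C}^m:|u_1|^2+\cdots+|u_m|^2=1\}$. For $u\in S^{2m-1}$ the directional derivative of $f$ along $u$ is $\partial_u(f)=\sum_{j=1}^m u_j\,\partial f/\partial z_j$, and the $k$-th order directional derivative is defined inductively by $\partial_u^1(f)=\partial_u(f)$, $\partial_u^k(f)=\partial_u(\partial_u^{k-1}(f))$. For a holomorphic function $g\not\equiv 0$ near a point $a\in\mathbb{C}^m$, expand $g(z)=\sum_{i\ge 0}P_i(z-a)$ with $P_i$ either identically zero or a homogeneous polynomial of degree $i$; the zero multiplicity of $g$ at $a$ is $\mu_g^0(a)=\min\{i:P_i\not\equiv 0\}$. Two entire functions $F,G$ on $\mathbb{C}^m$ share the value $1$ IM (ignoring multiplicities) if $\min\{\mu^0_{F-1},1\}=\min\{\mu^0_{G-1},1\}$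 on $\mathbb{C}^m$, i.e. $F-1$ and $G-1$ have the same zero set.
   Formalization: The "In particular" clause is false as printed (f=e^{z_j/n}; f=z_2e^{z_1/n}); proved instead: f=e^{z_j/c}β with β entire and free of z_j; f=e^{z_j/c+α} if f has no zeros; α non-constant if f is not a function of z_j alone. *)

theory Defs
  imports "HOL-Analysis.Analysis" "HOL-Library.Extended_Nat"
begin

text \<open>Entire means complex Frechet differentiable at every point: the derivative is
  \<open>\<complex>\<close>-linear, not merely \<open>\<real>\<close>-linear.\<close>

definition entire :: "(complex ^ 'm \<Rightarrow> complex) \<Rightarrow> bool" where
  "entire f \<longleftrightarrow>
     (\<forall>a. \<exists>A :: complex ^ 'm. (f has_derivative (\<lambda>h. \<Sum>j\<in>UNIV. A $ j * h $ j)) (at a))"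

definition partial_deriv :: "'m \<Rightarrow> (complex ^ 'm \<Rightarrow> complex) \<Rightarrow> complex ^ 'm \<Rightarrow> complex" where
  "partial_deriv j f z = deriv (\<lambda>t. f (z + axis j t)) 0"

definition dir_deriv ::
  "complex ^ 'm \<Rightarrow> (complex ^ 'm \<Rightarrow> complex) \<Rightarrow> complex ^ 'm \<Rightarrow> complex" where
  "dir_deriv u f z = (\<Sum>j\<in>UNIV. u $ j * partial_deriv j f z)"

text \<open>The zero polynomial counts as homogeneous of every degree.\<close>

definition homogeneous_poly :: "nat \<Rightarrow> (complex ^ 'm \<Rightarrow> complex) \<Rightarrow> bool" where
  "homogeneous_poly i P \<longleftrightarrow>
     (\<exists>b :: ('m \<Rightarrow> nat) \<Rightarrow> complex.
        \<forall>z. P z = (\<Sum>\<nu> | (\<Sum>j\<in>UNIV. \<nu> j) = i. b \<nu> * (\<Prod>j\<in>UNIV. (z $ j) ^ \<nu> j)))"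

definition homogeneous_expansion ::
  "(complex ^ 'm \<Rightarrow> complex) \<Rightarrow> complex ^ 'm \<Rightarrow> (nat \<Rightarrow> complex ^ 'm \<Rightarrow> complex) \<Rightarrow> bool" where
  "homogeneous_expansion g a P \<longleftrightarrow>
     (\<forall>i. homogeneous_poly i (P i)) \<and>
     (\<exists>r>0. \<forall>z\<in>ball a r. (\<lambda>i. P i (z - a)) sums g z)"

text \<open>The expansion of a function holomorphic near \<open>a\<close> exists and is unique, so the description
  below is proper. The value is \<open>\<infinity>\<close> when \<open>g\<close> vanishes identically near \<open>a\<close>.\<close>

definition zero_mult :: "(complex ^ 'm \<Rightarrow> complex) \<Rightarrow> complex ^ 'm \<Rightarrow> enat" where
  "zero_mult g a =
     (THE d. \<exists>P. homogeneous_expansion g a P \<and> d = (INF i\<in>{i. \<exists>z. P i z \<noteq> 0}. enat i))"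

definition share_IM ::
  "complex \<Rightarrow> (complex ^ 'm \<Rightarrow> complex) \<Rightarrow> (complex ^ 'm \<Rightarrow> complex) \<Rightarrow> bool" where
  "share_IM v F G \<longleftrightarrow>
     (\<forall>z. min (zero_mult (\<lambda>w. F w - v) z) 1 = min (zero_mult (\<lambda>w. G w - v) z) 1)"

text \<open>Entire functions of the \<open>m - 1\<close> variables other than \<open>z\<^sub>j\<close> are represented by entire
  functions of all \<open>m\<close> variables that do not depend on \<open>z\<^sub>j\<close>; this also covers \<open>m = 1\<close>.\<close>

definition indep_of_coord :: "'m \<Rightarrow> (complex ^ 'm \<Rightarrow> complex) \<Rightarrow> bool" where
  "indep_of_coord j \<alpha> \<longleftrightarrow> (\<forall>z w. (\<forall>i. i \<noteq> j \<longrightarrow> z $ i = w $ i) \<longrightarrow> \<alpha> z = \<alpha> w)"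

end

theory Submission
  imports Defs "HOL-Complex_Analysis.Complex_Analysis" "HOL-Real_Asymp.Real_Asymp"
begin

unbundle no fps_syntax

text \<open>
  On the complex line \<open>t \<mapsto> z + t u\<close> the operator \<open>\<partial>\<^sub>u\<close> is differentiation in \<open>t\<close>, so the heart of the
  matter is a theorem about one variable (\<open>power_sharing_one_variable\<close>): if \<open>g\<close> is entire,
  \<open>F = g\<^sup>n\<close> with \<open>n \<ge> k + 2\<close>, the \<open>k\<close>-th derivative \<open>K\<close> of \<open>F\<close> is not identically zero, and \<open>K = 1\<close>
  wherever \<open>F = 1\<close>, then \<open>g = c g'\<close> with \<open>(c/n)\<^sup>k = 1\<close>.

  Suppose first that \<open>K \<noteq> F\<close>, and put \<open>\<phi> = F' (K - F) / (F (F - 1))\<close>.  This function is entire: a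
  simple pole of \<open>F' / (F - 1)\<close> sits at a \<open>1\<close>-point of \<open>F\<close>, where \<open>K - F\<close> vanishes, and at a zero of
  \<open>F\<close> of order \<open>p\<close> the function \<open>\<phi>\<close> has a zero of order at least \<open>p - k - 1\<close>.  As \<open>p \<ge> n \<ge> k + 2\<close> one
  has \<open>(k + 2) (p - k - 1) \<ge> p\<close>, so \<open>\<psi> = \<phi>\<^bsup>k+2\<^esup> / F\<close> is entire too; this is where the hypothesis on
  \<open>n\<close> enters.  Now \<open>\<phi>\<close> and \<open>\<phi> / F\<close> are polynomials in the logarithmic derivatives of \<open>F - 1\<close>, \<open>F\<close> and
  the derivatives of \<open>F\<close> of order below \<open>k\<close>.  Write \<open>A(r)\<close> for the logarithm of the maximum modulus
  of \<open>F\<close> on the disc of radius \<open>r\<close>, let \<open>\<rho> < R\<close>, and put \<open>X = R / (R - \<rho>)\<close>.  On a circle between the two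
  radii that keeps away from the zeros of these functions, their logarithmic derivatives are bounded
  by powers of \<open>A(R)\<close> and \<open>X\<close> (\<open>log_derivs_bounded_on_circle\<close>).  Hence \<open>F = \<phi>\<^bsup>k+2\<^esup> / \<psi>\<close> is a quotient
  of two entire functions that are tiny compared with the maximum modulus of \<open>F\<close>, and Harnack's
  inequality, after division by the zeros of \<open>\<psi>\<close>, passes this bound on to \<open>F\<close>
  (\<open>entire_quotient_bound\<close>).  The result is \<open>A(\<rho>) \<le> C X (1 + ln A(R) + ln X)\<close>, which by a Borel growth
  argument forces \<open>A\<close> to be bounded (\<open>bounded_if_slow_self_growth\<close>); so \<open>F\<close> is constant, a contradiction.
  This is the argument of Nevanlinna's second main theorem, with mean values over circles replaced
  by pointwise bounds on well chosen circles.

  Hence \<open>K = F\<close>.  At a zero of \<open>g\<close> all derivatives of \<open>F\<close> of order below \<open>n\<close> vanish, and then all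
  derivatives, because the sequence of derivatives has period \<open>k\<close>; so \<open>F\<close> has no zeros.  The same
  periodicity bounds \<open>F\<close> by a multiple of \<open>exp \<bar>z\<bar>\<close>, so \<open>F' / F\<close> is a bounded entire function, that
  is, a constant \<open>l\<close> with \<open>l\<^sup>k = 1\<close>, and \<open>c = n / l\<close>.

  In several variables each point \<open>z\<close> satisfies \<open>\<partial>\<^sub>u\<^sup>k (f\<^sup>n) (z) = 0\<close> or \<open>f z = c \<partial>\<^sub>u f z\<close> for one of
  finitely many \<open>c\<close>.  Finitely many entire functions, none of which is identically zero, have a
  common point of non-vanishing (\<open>entire_common_nonzero_point\<close>), so one of these alternatives holds
  identically, and the first one is excluded by hypothesis.

  Sharing a value is defined by multiplicities, hence by homogeneous expansions.  Their existence
  rests on the fact that partial derivatives of entire functions are entire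
  (\<open>entire_partial_deriv\<close>), which is obtained by differentiating Cauchy's formula under the integral.
\<close>

section \<open>Zero-free functions with one-sided bounds\<close>

text \<open>The Cayley transform \<open>(p - c) / (p + c)\<close> maps the right half plane to the unit disc and \<open>c\<close> to \<open>0\<close>,
so the Schwarz lemma applies to it; solving for \<open>p\<close> gives the bound.\<close>

lemma positive_real_part_bound:
  assumes hol: "p holomorphic_on ball 0 R"
    and pos: "\<And>z. z \<in> ball 0 R \<Longrightarrow> Re (p z) > 0"
    and p0: "p 0 = of_real c" and z: "cmod z < R"
  shows "cmod (p z) \<le> 2 * R / (R - cmod z) * c"
proof -
  have R: "R > 0" using z norm_ge_zero[of z] by linarith
  have c: "c > 0" using pos[of 0] R p0 by simp
  define w where "w \<zeta> = (p (of_real R * \<zeta>) - of_real c) / (p (of_real R * \<zeta>) + of_real c)" for \<zeta>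
  have inb: "of_real R * \<zeta> \<in> ball 0 R" if "\<zeta> \<in> ball 0 1" for \<zeta> :: complex
    using that R by (simp add: norm_mult)
  have den: "p y + of_real c \<noteq> 0" if "y \<in> ball 0 R" for y
    using pos[OF that] c by (auto simp: complex_eq_iff)
  have wlt: "cmod (w \<zeta>) < 1" if "cmod \<zeta> < 1" for \<zeta>
  proof -
    let ?q = "p (of_real R * \<zeta>)"
    have q: "Re ?q > 0" using pos inb that by simp
    have "(cmod (?q - of_real c))\<^sup>2 < (cmod (?q + of_real c))\<^sup>2"
      using mult_pos_pos[OF q c] by (simp only: cmod_power2) (simp add: power2_eq_square algebra_simps)
    hence "cmod (?q - of_real c) < cmod (?q + of_real c)"
      by (rule power_less_imp_less_base) simp
    thus ?thesis unfolding w_def using den inb that by (simp add: norm_divide)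
  qed
  have whol: "w holomorphic_on ball 0 1"
    unfolding w_def
    by (intro holomorphic_intros holomorphic_on_compose_gen[OF _ hol, unfolded o_def])
       (use inb den in auto)
  let ?\<xi> = "z / of_real R"
  have xi: "cmod ?\<xi> < 1" using z R by (simp add: norm_divide)
  have wz: "cmod (w ?\<xi>) \<le> cmod ?\<xi>"
    by (rule Schwarz_Lemma(1)[OF whol]) (use wlt xi p0 in \<open>auto simp: w_def\<close>)
  define v where "v = w ?\<xi>"
  define t where "t = cmod z / R"
  have t: "t < 1" "cmod v \<le> t" "t \<ge> 0" using wz xi R by (auto simp: v_def t_def norm_divide)
  have veq: "v = (p z - of_real c) / (p z + of_real c)" using R by (simp add: v_def w_def)
  have "v * (p z + of_real c) = p z - of_real c"
    using veq den[of z] z by simp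
  hence pe: "p z * (1 - v) = of_real c * (1 + v)" by (simp add: algebra_simps)
  have "cmod (1 - v) \<ge> 1 - t" using t norm_triangle_ineq2[of 1 v] by simp
  hence "cmod (p z) * (1 - t) \<le> cmod (p z) * cmod (1 - v)" by (simp add: mult_left_mono)
  also have "\<dots> = c * cmod (1 + v)" using arg_cong[OF pe, of cmod] c by (simp add: norm_mult)
  also have "\<dots> \<le> c * 2" using norm_triangle_ineq[of 1 v] t c by (intro mult_left_mono) auto
  finally have "cmod (p z) \<le> 2 * c / (1 - t)" using t by (simp add: field_simps)
  also have "\<dots> = 2 * R / (R - cmod z) * c" using R z by (simp add: t_def field_simps)
  finally show ?thesis .
qed

text \<open>A Harnack bound from below for \<open>ln \<bar>H\<bar>\<close> and a bound for \<open>H' / H\<close>.  Both come from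
\<open>p = A - ln H\<close>, which has positive real part: the first is its modulus bound, the second
is Cauchy's inequality for \<open>p'\<close> on a disc reaching halfway to the boundary.\<close>

lemma zero_free_bounds:
  assumes hol: "H holomorphic_on ball 0 R"
    and nz: "\<And>z. z \<in> ball 0 R \<Longrightarrow> H z \<noteq> 0"
    and bd: "\<And>z. z \<in> ball 0 R \<Longrightarrow> cmod (H z) < exp A" and z: "cmod z < R"
  shows "A - ln (cmod (H z)) \<le> 2 * R / (R - cmod z) * (A - ln (cmod (H 0)))"
    and "cmod (deriv H z / H z) \<le> 8 * R / (R - cmod z)\<^sup>2 * (A - ln (cmod (H 0)))"
proof -
  have R: "R > 0" using z norm_ge_zero[of z] by linarith
  obtain h where h: "h holomorphic_on ball 0 R" "\<And>z. z \<in> ball 0 R \<Longrightarrow> H z = exp (h z)"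
    using contractible_imp_holomorphic_log[OF hol convex_imp_contractible[OF convex_ball] nz] by blast
  have lnH: "ln (cmod (H y)) = Re (h y)" if "y \<in> ball 0 R" for y
    using h(2)[OF that] by simp
  \<comment> \<open>The imaginary constant makes \<open>p 0\<close> real, as the modulus bound requires.\<close>
  define p where "p y = of_real A - h y + \<i> * of_real (Im (h 0))" for y
  define c where "c = A - ln (cmod (H 0))"
  have phol: "p holomorphic_on ball 0 R" unfolding p_def by (intro holomorphic_intros h)
  have Rep: "Re (p y) = A - ln (cmod (H y))" if "y \<in> ball 0 R" for y
    using lnH[OF that] by (simp add: p_def)
  have ppos: "Re (p y) > 0" if "y \<in> ball 0 R" for y
    using bd[OF that] nz[OF that] Rep[OF that]
    by (metis diff_gt_0_iff_gt exp_gt_zero ln_exp ln_less_cancel_iff zero_less_norm_iff)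
  have p0: "p 0 = of_real c" using lnH[of 0] R by (simp add: p_def c_def complex_eq_iff)
  have cpos: "c > 0" using ppos[of 0] p0 R by simp
  note pb = positive_real_part_bound[OF phol ppos p0]
  have "A - ln (cmod (H z)) \<le> cmod (p z)"
    using Rep[of z] z complex_Re_le_cmod[of "p z"] by simp
  thus "A - ln (cmod (H z)) \<le> 2 * R / (R - cmod z) * (A - ln (cmod (H 0)))"
    using pb[OF _ z] by (simp add: c_def)
  define s where "s = (R - cmod z) / 2"
  have s: "s > 0" using z by (simp add: s_def)
  have sub: "cmod y \<le> cmod z + s" "cmod y < R" if "y \<in> cball z s" for y
  proof -
    have "cmod (y - z) \<le> s" using that by (simp add: dist_norm norm_minus_commute)
    thus "cmod y \<le> cmod z + s" using norm_triangle_sub[of y z] by simp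
    thus "cmod y < R" using z by (simp add: s_def field_simps)
  qed
  have sb: "cball z s \<subseteq> ball 0 R" using sub by auto
  have bnd: "cmod (p y) \<le> 2 * R / s * c" if "y \<in> cball z s" for y
  proof -
    have "s \<le> R - cmod y" using sub(1)[OF that] unfolding s_def by (simp add: field_simps)
    hence "2 * R / (R - cmod y) \<le> 2 * R / s"
      using s R sub(2)[OF that] by (intro divide_left_mono mult_pos_pos) auto
    thus ?thesis using pb[OF _ sub(2)[OF that]] cpos mult_right_mono[of _ _ c] by fastforce
  qed
  have "cmod ((deriv ^^ 1) p z) \<le> fact 1 * (2 * R / s * c) / s ^ 1"
    by (rule Cauchy_inequality)
       (use s bnd sb ball_subset_cball[of z s] phol in
         \<open>auto intro!: holomorphic_on_imp_continuous_on elim!: holomorphic_on_subset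
            simp: dist_norm norm_minus_commute\<close>)
  hence dp: "cmod (deriv p z) \<le> 8 * R / (R - cmod z)\<^sup>2 * c"
    by (simp add: s_def power2_eq_square)
  have zb: "z \<in> ball 0 R" using z by simp
  have hd: "(h has_field_derivative deriv h z) (at z)"
    using holomorphic_derivI[OF h(1) open_ball zb] .
  have "(p has_field_derivative - deriv h z) (at z)"
    unfolding p_def by (auto intro!: derivative_eq_intros hd)
  hence "deriv p z = - deriv h z" by (rule DERIV_imp_deriv)
  moreover have "(H has_field_derivative exp (h z) * deriv h z) (at z)"
  proof (rule has_field_derivative_transform_within_open[OF _ open_ball zb])
    show "((\<lambda>y. exp (h y)) has_field_derivative exp (h z) * deriv h z) (at z)"
      by (auto intro!: derivative_eq_intros hd)
  qed (use h in auto)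
  hence "deriv H z = H z * deriv h z" using DERIV_imp_deriv h(2)[OF zb] by metis
  hence "deriv H z / H z = deriv h z" using nz[OF zb] by simp
  ultimately show "cmod (deriv H z / H z) \<le> 8 * R / (R - cmod z)\<^sup>2 * (A - ln (cmod (H 0)))"
    using dp by (simp add: c_def)
qed

section \<open>Blaschke factorization on a disc\<close>

lemma divide_out_zero:
  fixes E :: "complex \<Rightarrow> complex"
  assumes "E holomorphic_on UNIV" "E a = 0"
  obtains E' where "E' holomorphic_on UNIV" "\<And>z. E z = (z - a) * E' z"
proof
  show "(\<lambda>z. if z = a then deriv E a else (E z - E a) / (z - a)) holomorphic_on UNIV"
    by (rule pole_lemma) (use assms in auto)
qed (use assms in auto)

lemma holomorphic_on_prod_list:
  assumes "\<And>a. a \<in> set as \<Longrightarrow> f a holomorphic_on S"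
  shows "(\<lambda>z. \<Prod>a\<leftarrow>as. f a z) holomorphic_on S"
  using assms by (induction as) (auto intro!: holomorphic_intros)

lemma norm_prod_list: "cmod (prod_list xs) = prod_list (map cmod xs)"
  by (induction xs) (auto simp: norm_mult)

lemma entire_bound_from_circle:
  assumes "f holomorphic_on UNIV" "0 < R" "\<And>z. cmod z = R \<Longrightarrow> cmod (f z) \<le> B" "cmod z \<le> R"
  shows "cmod (f z) \<le> B"
proof (rule maximum_modulus_frontier[of f "cball 0 R"])
  show "continuous_on (closure (cball 0 R)) f"
    using assms(1) holomorphic_on_imp_continuous_on holomorphic_on_subset by blast
qed (use assms in \<open>auto intro: holomorphic_on_subset\<close>)

text \<open>The Blaschke product of the disc of radius \<open>R\<close> with zeros \<open>as\<close>, split into numerator and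
denominator, so that the factorization of an entire function stays an identity between entire functions.\<close>

definition blaschke_num :: "complex list \<Rightarrow> complex \<Rightarrow> complex" where
  "blaschke_num as z = (\<Prod>a\<leftarrow>as. z - a)"

definition blaschke_den :: "real \<Rightarrow> complex list \<Rightarrow> complex \<Rightarrow> complex" where
  "blaschke_den R as z = (\<Prod>a\<leftarrow>as. of_real R - cnj a * z / of_real R)"

lemma blaschke_eq_on_circle:
  assumes "0 < R" "cmod z = R"
  shows "cmod (blaschke_num as z) = cmod (blaschke_den R as z)"
proof -
  have "cmod (z - a) = cmod (of_real R - cnj a * z / of_real R)" for a
  proof -
    have zz: "z * cnj z = of_real R * of_real R" using assms
      by (metis complex_norm_square power2_eq_square of_real_mult)
    have "z * cnj (z - a) = of_real R * (of_real R - cnj a * z / of_real R)"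
      using zz assms by (simp add: algebra_simps)
    from arg_cong[OF this, of cmod] show ?thesis
      using assms by (simp add: norm_mult del: complex_cnj_diff)
  qed
  thus ?thesis by (simp add: blaschke_num_def blaschke_den_def norm_prod_list o_def)
qed

lemma blaschke_den_0: "0 < R \<Longrightarrow> blaschke_den R as 0 = of_real R ^ length as"
  by (induction as) (auto simp: blaschke_den_def)

lemma holomorphic_blaschke:
  "blaschke_num as holomorphic_on S" "blaschke_den R as holomorphic_on S"
  unfolding blaschke_num_def[abs_def] blaschke_den_def[abs_def] divide_inverse
  by (intro holomorphic_on_prod_list holomorphic_intros)+

text \<open>Dividing \<open>G\<close> by Blaschke factors preserves its modulus on \<open>\<bar>z\<bar> = R\<close> and multiplies
\<open>\<bar>G 0\<bar>\<close> by at least \<open>R / R1\<close> for each zero removed.  So the maximum principle bounds the number of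
zeros that can be removed from the disc of radius \<open>R1\<close>, and a list of maximal length leaves a
quotient \<open>H\<close> without zeros there.\<close>

lemma blaschke_factorization:
  assumes hol: "G holomorphic_on UNIV" and G0: "G 0 \<noteq> 0" and R: "0 < R1" "R1 < R"
    and bd: "\<And>z. cmod z \<le> R \<Longrightarrow> cmod (G z) \<le> exp A"
  obtains as H where "H holomorphic_on UNIV" "\<And>a. a \<in> set as \<Longrightarrow> cmod a \<le> R1"
    "\<And>z. G z * blaschke_den R as z = H z * blaschke_num as z"
    "\<And>z. cmod z \<le> R \<Longrightarrow> cmod (H z) \<le> exp A" "\<And>z. cmod z \<le> R1 \<Longrightarrow> H z \<noteq> 0"
    "cmod (G 0) \<le> cmod (H 0)" "length as * ln (R / R1) \<le> A - ln (cmod (G 0))"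
proof -
  define good where "good as \<longleftrightarrow> (\<forall>a\<in>set as. cmod a \<le> R1) \<and>
    (\<exists>E. E holomorphic_on UNIV \<and> (\<forall>z. G z = E z * blaschke_num as z))" for as
  have lnR: "ln (R / R1) > 0" using R by simp
  \<comment> \<open>The Jensen-type count, valid for every list of zeros that divides \<open>G\<close>, maximal or not.\<close>
  have *: "cmod (G 0) \<le> cmod (E 0 * blaschke_den R as 0) \<and> length as * ln (R / R1) \<le> A - ln (cmod (G 0))
      \<and> (\<forall>z. cmod z \<le> R \<longrightarrow> cmod (E z * blaschke_den R as z) \<le> exp A)"
    if as: "\<forall>a\<in>set as. cmod a \<le> R1" and E: "E holomorphic_on UNIV" "\<And>z. G z = E z * blaschke_num as z"
    for as E
  proof -
    have bound: "cmod (E z * blaschke_den R as z) \<le> exp A" if "cmod z \<le> R" for z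
    proof (rule entire_bound_from_circle[of "\<lambda>z. E z * blaschke_den R as z" R])
      show "(\<lambda>z. E z * blaschke_den R as z) holomorphic_on UNIV"
        by (intro holomorphic_intros holomorphic_blaschke E)
      show "cmod (E z * blaschke_den R as z) \<le> exp A" if "cmod z = R" for z
        using bd[of z] that R E(2)[of z] blaschke_eq_on_circle[of R z as] by (simp add: norm_mult)
    qed (use R that in auto)
    have num0: "cmod (blaschke_num as 0) \<le> R1 ^ length as"
      using as
    proof (induction as)
      case (Cons a as)
      thus ?case using R by (auto simp: blaschke_num_def norm_mult intro!: mult_mono)
    qed (simp add: blaschke_num_def)
    have E0: "cmod (G 0) \<le> cmod (E 0) * R1 ^ length as"
      using num0 E(2)[of 0] by (simp add: norm_mult mult_left_mono)
    have "cmod (E 0) * R ^ length as \<le> exp A"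
      using bound[of 0] R by (simp add: norm_mult blaschke_den_0 norm_power)
    hence "cmod (G 0) * R ^ length as \<le> exp A * R1 ^ length as"
      using E0 R by (smt (verit) mult.assoc mult.commute mult_right_mono zero_le_power)
    hence "cmod (G 0) * (R / R1) ^ length as \<le> exp A"
      using R by (simp add: power_divide field_simps)
    hence "ln (cmod (G 0) * (R / R1) ^ length as) \<le> ln (exp A)"
      using G0 R by (subst ln_le_cancel_iff) auto
    hence "length as * ln (R / R1) \<le> A - ln (cmod (G 0))"
      using G0 R by (simp add: ln_mult ln_realpow)
    moreover have "R1 ^ length as \<le> R ^ length as" using R by (intro power_mono) auto
    hence "cmod (G 0) \<le> cmod (E 0 * blaschke_den R as 0)"
      using E0 R by (simp add: norm_mult norm_power blaschke_den_0)
        (smt (verit) mult_left_mono norm_ge_zero)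
    ultimately show ?thesis using bound by auto
  qed
  have len: "length as \<le> nat \<lceil>(A - ln (cmod (G 0))) / ln (R / R1)\<rceil>" if "good as" for as
  proof -
    from that obtain E where "\<forall>a\<in>set as. cmod a \<le> R1" "E holomorphic_on UNIV" "\<And>z. G z = E z * blaschke_num as z"
      by (auto simp: good_def)
    from *[OF this] have "real (length as) \<le> (A - ln (cmod (G 0))) / ln (R / R1)"
      using lnR by (simp add: field_simps)
    thus ?thesis by linarith
  qed
  have "good []" using hol by (auto simp: good_def blaschke_num_def)
  then obtain as where as: "good as" "\<And>bs. good bs \<Longrightarrow> length bs \<le> length as"
    using ex_has_greatest_nat[of good "[]" length] len by (metis le_imp_less_Suc)
  then obtain E where a: "\<forall>a\<in>set as. cmod a \<le> R1" and E: "E holomorphic_on UNIV" "\<And>z. G z = E z * blaschke_num as z"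
    by (auto simp: good_def)
  have Enz: "E z \<noteq> 0" if z: "cmod z \<le> R1" for z
  proof
    assume "E z = 0"
    then obtain E' where E': "E' holomorphic_on UNIV" "\<And>w. E w = (w - z) * E' w"
      using divide_out_zero[OF E(1)] by blast
    have "G w = E' w * blaschke_num (z # as) w" for w
      using E(2)[of w] E'(2)[of w] by (simp add: blaschke_num_def)
    hence "good (z # as)" using a z E'(1) by (auto simp: good_def)
    thus False using as(2)[of "z # as"] by simp
  qed
  have den: "blaschke_den R as z \<noteq> 0" if "cmod z \<le> R1" for z
  proof -
    have "of_real R - cnj a * z / of_real R \<noteq> 0" if "a \<in> set as" for a
    proof
      assume "of_real R - cnj a * z / of_real R = 0"
      hence "cnj a * z = of_real R * of_real R" using R by (simp add: field_simps)
      hence "cmod a * cmod z = R * R" using R by (metis abs_of_pos complex_mod_cnj norm_mult norm_of_real order.strict_trans)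
      moreover have "cmod a * cmod z \<le> R1 * R1" using a that \<open>cmod z \<le> R1\<close> R by (intro mult_mono) auto
      moreover have "R1 * R1 < R * R" using R by (intro mult_strict_mono) auto
      ultimately show False by simp
    qed
    thus ?thesis by (simp add: blaschke_den_def prod_list_zero_iff image_iff)
  qed
  show thesis
    by (rule that[of "\<lambda>z. E z * blaschke_den R as z" as])
       (use *[OF a E] a E den Enz in \<open>auto intro!: holomorphic_intros holomorphic_blaschke\<close>)
qed

section \<open>Logarithmic derivatives on circles that avoid the zeros\<close>

lemma has_field_derivative_prod_list:
  fixes f :: "'a \<Rightarrow> complex \<Rightarrow> complex"
  assumes "\<And>a. a \<in> set as \<Longrightarrow> (f a has_field_derivative f' a) (at z) \<and> f a z \<noteq> 0"
  shows "((\<lambda>w. \<Prod>a\<leftarrow>as. f a w) has_field_derivative (\<Prod>a\<leftarrow>as. f a z) * (\<Sum>a\<leftarrow>as. f' a / f a z)) (at z)"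
  using assms
proof (induction as)
  case (Cons a as)
  have *: "((\<lambda>w. f a w * (\<Prod>a\<leftarrow>as. f a w)) has_field_derivative
     f' a * (\<Prod>a\<leftarrow>as. f a z) + (\<Prod>a\<leftarrow>as. f a z) * (\<Sum>a\<leftarrow>as. f' a / f a z) * f a z) (at z)"
    using Cons by (intro DERIV_mult) auto
  moreover have "f' a * (\<Prod>a\<leftarrow>as. f a z) + (\<Prod>a\<leftarrow>as. f a z) * (\<Sum>a\<leftarrow>as. f' a / f a z) * f a z
      = f a z * (\<Prod>a\<leftarrow>as. f a z) * (f' a / f a z + (\<Sum>a\<leftarrow>as. f' a / f a z))"
    using Cons.prems[of a] by (simp add: field_simps)
  ultimately show ?case by (simp add: mult.assoc)
qed simp

lemma norm_sum_list_le:
  fixes B :: real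
  assumes "\<And>a. a \<in> set as \<Longrightarrow> cmod (f a) \<le> B"
  shows "cmod (\<Sum>a\<leftarrow>as. f a) \<le> length as * B"
  using assms
proof (induction as)
  case (Cons a as)
  have "cmod (f a + (\<Sum>a\<leftarrow>as. f a)) \<le> cmod (f a) + cmod (\<Sum>a\<leftarrow>as. f a)" by (rule norm_triangle_ineq)
  also have "\<dots> \<le> B + length as * B" using Cons by (intro add_mono) auto
  finally show ?case by (simp add: algebra_simps)
qed simp

text \<open>In the factorization of \<open>G\<close> the logarithmic derivative splits into that of the zero-free part, a
term \<open>1 / (z - a)\<close> for each zero \<open>a\<close>, and the denominators, which are harmless because
their zeros lie outside the disc of radius \<open>\<rho> + 3\<delta>\<close>.  So \<open>G' / G\<close> is controlled at every point that has
distance at least \<open>\<eta>\<close> from the listed zeros.\<close>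

lemma log_deriv_bound:
  assumes hol: "G holomorphic_on UNIV" and G0: "G 0 \<noteq> 0" and \<rho>: "0 < \<rho>" and \<delta>: "0 < \<delta>"
    and bd: "\<And>z. cmod z \<le> \<rho> + 3 * \<delta> \<Longrightarrow> cmod (G z) \<le> exp A"
    and P: "A + 1 - ln (cmod (G 0)) \<le> P"
  obtains as where "length as \<le> P * ((\<rho> + 3 * \<delta>) / \<delta>)"
    "\<And>z \<eta>. cmod z \<le> \<rho> + \<delta> \<Longrightarrow> 0 < \<eta> \<Longrightarrow> (\<And>a. a \<in> set as \<Longrightarrow> \<eta> \<le> cmod (z - a)) \<Longrightarrow>
      G z \<noteq> 0 \<and> cmod (deriv G z / G z) \<le> length as / \<eta> + length as / \<delta> + 8 * (\<rho> + 3 * \<delta>) / \<delta>\<^sup>2 * P"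
proof -
  define R where "R = \<rho> + 3 * \<delta>"
  define R1 where "R1 = \<rho> + 2 * \<delta>"
  have R: "0 < R1" "R1 < R" using \<rho> \<delta> by (auto simp: R_def R1_def)
  have R0: "R > 0" using R by simp
  obtain as H where H: "H holomorphic_on UNIV" and as: "\<And>a. a \<in> set as \<Longrightarrow> cmod a \<le> R1"
    and eq: "\<And>z. G z * blaschke_den R as z = H z * blaschke_num as z"
    and Hb: "\<And>z. cmod z \<le> R \<Longrightarrow> cmod (H z) \<le> exp A" and Hnz: "\<And>z. cmod z \<le> R1 \<Longrightarrow> H z \<noteq> 0"
    and H0: "cmod (G 0) \<le> cmod (H 0)" and len: "length as * ln (R / R1) \<le> A - ln (cmod (G 0))"
    by (rule blaschke_factorization[OF hol G0 R bd[folded R_def]]) (assumption, rule that)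
  show thesis
  proof (rule that[of as])
    have "ln (R1 / R) \<le> R1 / R - 1" using R by (intro ln_le_minus_one) auto
    also have "R1 / R - 1 = - \<delta> / R" using R by (simp add: R_def R1_def field_simps)
    finally have "\<delta> / R \<le> ln (R / R1)" using R by (simp add: ln_div)
    hence "length as * (\<delta> / R) \<le> length as * ln (R / R1)" by (intro mult_left_mono) auto
    hence "length as * (\<delta> / R) \<le> P" using len P by linarith
    thus "length as \<le> P * ((\<rho> + 3 * \<delta>) / \<delta>)" using R \<delta> by (simp add: R_def field_simps)
  next
    fix z \<eta> assume z: "cmod z \<le> \<rho> + \<delta>" and \<eta>: "0 < \<eta>" and far: "\<And>a. a \<in> set as \<Longrightarrow> \<eta> \<le> cmod (z - a)"
    have zR1: "cmod z \<le> R1" using z \<delta> by (simp add: R1_def)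
    have Hz: "H z \<noteq> 0" using Hnz zR1 by simp
    define N D where "N = blaschke_num as" and "D = blaschke_den R as"
    define S T where "S = (\<Sum>a\<leftarrow>as. 1 / (z - a))"
      and "T = (\<Sum>a\<leftarrow>as. (- cnj a / of_real R) / (of_real R - cnj a * z / of_real R))"
    have den: "cmod (of_real R - cnj a * z / of_real R) \<ge> \<delta>" if a: "a \<in> set as" for a
    proof -
      have "cmod a / R \<le> 1" using as[OF a] R by simp
      hence "cmod a / R * cmod z \<le> 1 * cmod z" by (intro mult_right_mono) auto
      hence "cmod (cnj a * z / of_real R) \<le> cmod z" using R by (simp add: norm_mult norm_divide)
      moreover have "cmod (of_real R) - cmod (cnj a * z / of_real R) \<le> cmod (of_real R - cnj a * z / of_real R)"
        by (rule norm_triangle_ineq2)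
      moreover have "cmod (of_real R) = R" using R by simp
      moreover have "R = \<rho> + 3 * \<delta>" by (simp add: R_def)
      ultimately show ?thesis using z \<delta> by linarith
    qed
    have anz: "z - a \<noteq> 0" if "a \<in> set as" for a using far[OF that] \<eta> by auto
    have dN: "(N has_field_derivative N z * S) (at z)"
      unfolding N_def S_def blaschke_num_def[abs_def]
      using anz by (intro has_field_derivative_prod_list) (auto intro!: derivative_eq_intros)
    have dD: "(D has_field_derivative D z * T) (at z)"
      unfolding D_def T_def blaschke_den_def[abs_def]
      using den \<delta> R by (intro has_field_derivative_prod_list) (fastforce intro!: derivative_eq_intros)
    have N0: "N z \<noteq> 0" unfolding N_def blaschke_num_def using anz by (auto simp: prod_list_zero_iff)
    have D0: "D z \<noteq> 0" unfolding D_def blaschke_den_def using den \<delta> by (fastforce simp: prod_list_zero_iff)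
    have Gz: "G z \<noteq> 0" using eq[of z] Hz N0 by (auto simp: N_def)
    have dG: "(G has_field_derivative deriv G z) (at z)" and dH: "(H has_field_derivative deriv H z) (at z)"
      using hol H holomorphic_derivI open_UNIV by blast+
    have "((\<lambda>z. G z * D z) has_field_derivative (deriv G z * D z + D z * T * G z)) (at z)"
      by (rule DERIV_mult[OF dG dD])
    moreover have "((\<lambda>z. H z * N z) has_field_derivative (deriv H z * N z + N z * S * H z)) (at z)"
      by (rule DERIV_mult[OF dH dN])
    moreover have "(\<lambda>z. G z * D z) = (\<lambda>z. H z * N z)" using eq by (simp add: N_def D_def)
    ultimately have e: "deriv G z * D z + D z * T * G z = deriv H z * N z + N z * S * H z"
      using DERIV_unique by metis
    have "deriv G z / G z + T = (deriv G z * D z + D z * T * G z) / (G z * D z)"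
      using Gz D0 by (simp add: field_simps)
    also have "\<dots> = (deriv H z * N z + N z * S * H z) / (H z * N z)"
      using e eq[of z] by (simp add: N_def D_def)
    also have "\<dots> = deriv H z / H z + S" using Hz N0 by (simp add: field_simps)
    finally have id: "deriv G z / G z = deriv H z / H z + S - T" by (simp add: algebra_simps)
    have Sb: "cmod S \<le> length as * (1 / \<eta>)" unfolding S_def
      by (rule norm_sum_list_le) (use far \<eta> in \<open>auto simp: norm_divide intro!: frac_le\<close>)
    have Tb: "cmod T \<le> length as * (1 / \<delta>)" unfolding T_def
    proof (rule norm_sum_list_le)
      fix a assume a: "a \<in> set as"
      show "cmod ((- cnj a / of_real R) / (of_real R - cnj a * z / of_real R)) \<le> 1 / \<delta>"
        unfolding norm_divide[of "- cnj a / of_real R"]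
        using den[OF a] as[OF a] R \<delta> by (intro frac_le) (auto simp: norm_divide)
    qed
    have "cmod (deriv H z / H z) \<le> 8 * R1 / (R1 - cmod z)\<^sup>2 * (A + 1 - ln (cmod (H 0)))"
    proof (rule zero_free_bounds(2))
      show "cmod (H w) < exp (A + 1)" if "w \<in> ball 0 R1" for w
        using Hb[of w] that R by (smt (verit) dist_0_norm exp_less_mono mem_ball)
    qed (use H Hnz z \<delta> in \<open>auto simp: R1_def intro: holomorphic_on_subset\<close>)
    also have "\<dots> \<le> 8 * R / \<delta>\<^sup>2 * P"
    proof (rule mult_mono)
      show "8 * R1 / (R1 - cmod z)\<^sup>2 \<le> 8 * R / \<delta>\<^sup>2"
        using R \<delta> z by (intro frac_le power_mono) (auto simp: R1_def)
      have "ln (cmod (G 0)) \<le> ln (cmod (H 0))" using H0 G0 Hnz[of 0] R by (subst ln_le_cancel_iff) auto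
      thus "A + 1 - ln (cmod (H 0)) \<le> P" using P by linarith
      have "cmod (H 0) \<le> exp A" using Hb[of 0] R by simp
      hence "ln (cmod (H 0)) \<le> ln (exp A)" using Hnz[of 0] R by (subst ln_le_cancel_iff) auto
      thus "0 \<le> A + 1 - ln (cmod (H 0))" by simp
      show "0 \<le> 8 * R / \<delta>\<^sup>2" using R0 by simp
    qed
    finally have "cmod (deriv H z / H z) \<le> 8 * R / \<delta>\<^sup>2 * P" .
    moreover have "cmod (deriv G z / G z) \<le> cmod (deriv H z / H z) + cmod S + cmod T"
      unfolding id by (meson norm_triangle_ineq norm_triangle_ineq4 add_mono order_refl order_trans)
    ultimately show "G z \<noteq> 0 \<and> cmod (deriv G z / G z) \<le> length as / \<eta> + length as / \<delta> + 8 * (\<rho> + 3 * \<delta>) / \<delta>\<^sup>2 * P"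
      using Gz Sb Tb by (simp add: R_def)
  qed
qed

text \<open>Pigeonhole: there is one more equally spaced point in the interval than there are elements of the
list, and each element is close to at most one of the points.\<close>

lemma real_far_from_list:
  fixes cs :: "real list"
  assumes "\<delta> > 0"
  obtains r where "\<rho> \<le> r" "r \<le> \<rho> + \<delta>" "\<And>c. c \<in> set cs \<Longrightarrow> \<delta> / (2 * (length cs + 1)) \<le> \<bar>r - c\<bar>"
proof -
  define s where "s = \<delta> / (length cs + 1)"
  have s: "s > 0" using assms by (simp add: s_def)
  define p where "p i = \<rho> + real i * s" for i
  have "\<exists>i\<le>length cs. \<forall>c\<in>set cs. s / 2 \<le> \<bar>p i - c\<bar>"
  proof (rule ccontr)
    assume "\<not> ?thesis"
    hence "\<exists>c\<in>set cs. \<bar>p i - c\<bar> < s / 2" if "i \<le> length cs" for i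
      using that unfolding not_le[symmetric] by blast
    then obtain c where c: "\<And>i. i \<le> length cs \<Longrightarrow> c i \<in> set cs \<and> \<bar>p i - c i\<bar> < s / 2"
      by metis
    have "inj_on c {..length cs}"
    proof (rule inj_onI)
      fix i j assume ij: "i \<in> {..length cs}" "j \<in> {..length cs}" "c i = c j"
      hence "\<bar>p i - c i\<bar> < s / 2" "\<bar>p j - c i\<bar> < s / 2" using c[of i] c[of j] by auto
      hence "\<bar>p i - p j\<bar> < s" by linarith
      hence "\<bar>real i - real j\<bar> * s < 1 * s" using s by (simp add: p_def abs_mult flip: left_diff_distrib)
      hence "\<bar>real i - real j\<bar> < 1" using s by (simp only: mult_less_cancel_right)
      thus "i = j" by linarith
    qed
    moreover have "c ` {..length cs} \<subseteq> set cs" using c by auto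
    ultimately have "card {..length cs} \<le> card (set cs)" by (intro card_inj_on_le) auto
    thus False using card_length[of cs] by simp
  qed
  then obtain i where i: "i \<le> length cs" "\<forall>c\<in>set cs. s / 2 \<le> \<bar>p i - c\<bar>" by auto
  have "real i * s \<le> (real (length cs) + 1) * s" using i s by (intro mult_right_mono) auto
  also have "\<dots> = \<delta>" using of_nat_0_le_iff[of "length cs", where 'a = real] unfolding s_def
    by (simp add: field_simps add_nonneg_eq_0_iff)
  finally have "p i \<le> \<rho> + \<delta>" by (simp add: p_def)
  moreover have "\<delta> / (2 * (length cs + 1)) = s / 2" by (simp add: s_def)
  moreover have "\<rho> \<le> p i" using s by (simp add: p_def)
  ultimately show thesis using that[of "p i"] i(2) by metis
qed

text \<open>One circle serves for finitely many functions: its radius is chosen away from the moduli of all their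
zeros.  The bound is polynomial in \<open>P\<close>, which will be about the logarithm of the maximum modulus.\<close>

lemma log_derivs_bounded_on_circle:
  fixes G :: "nat \<Rightarrow> complex \<Rightarrow> complex"
  assumes hol: "\<And>i. i \<le> m \<Longrightarrow> G i holomorphic_on UNIV" and G0: "\<And>i. i \<le> m \<Longrightarrow> G i 0 \<noteq> 0"
    and \<rho>: "0 < \<rho>" and \<delta>: "0 < \<delta>"
    and bd: "\<And>i z. i \<le> m \<Longrightarrow> cmod z \<le> \<rho> + 3 * \<delta> \<Longrightarrow> cmod (G i z) \<le> exp A"
    and P: "\<And>i. i \<le> m \<Longrightarrow> A + 1 - ln (cmod (G i 0)) \<le> P" and P1: "1 \<le> P"
  obtains r where "\<rho> \<le> r" "r \<le> \<rho> + \<delta>"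
    "\<And>i z. i \<le> m \<Longrightarrow> cmod z = r \<Longrightarrow> G i z \<noteq> 0 \<and>
      cmod (deriv (G i) z / G i z) \<le> 13 * ((real m + 1) * P * ((\<rho> + 3 * \<delta>) / \<delta>))\<^sup>2 / \<delta>"
proof -
  define X where "X = (\<rho> + 3 * \<delta>) / \<delta>"
  define Y where "Y = (real m + 1) * P * X"
  have X: "X \<ge> 1" using \<rho> \<delta> by (simp add: X_def)
  have PX: "P * X \<ge> 1" using mult_mono[OF P1 X] P1 by simp
  have YPX: "P * X \<le> Y" using mult_right_mono[of 1 "real m + 1" "P * X"] PX by (simp add: Y_def mult.assoc)
  have Y: "Y \<ge> 1" using YPX PX by linarith
  have "\<exists>as. length as \<le> P * X \<and> (\<forall>z \<eta>. cmod z \<le> \<rho> + \<delta> \<longrightarrow> 0 < \<eta> \<longrightarrow> (\<forall>a \<in> set as. \<eta> \<le> cmod (z - a)) \<longrightarrow>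
      G i z \<noteq> 0 \<and> cmod (deriv (G i) z / G i z) \<le> length as / \<eta> + length as / \<delta> + 8 * (\<rho> + 3 * \<delta>) / \<delta>\<^sup>2 * P)"
    if i: "i \<le> m" for i
    using log_deriv_bound[OF hol[OF i] G0[OF i] \<rho> \<delta> bd[OF i] P[OF i]] unfolding X_def by metis
  then obtain as where as: "\<And>i. i \<le> m \<Longrightarrow> length (as i) \<le> P * X \<and> (\<forall>z \<eta>. cmod z \<le> \<rho> + \<delta> \<longrightarrow> 0 < \<eta> \<longrightarrow>
      (\<forall>a \<in> set (as i). \<eta> \<le> cmod (z - a)) \<longrightarrow> G i z \<noteq> 0 \<and> cmod (deriv (G i) z / G i z)
      \<le> length (as i) / \<eta> + length (as i) / \<delta> + 8 * (\<rho> + 3 * \<delta>) / \<delta>\<^sup>2 * P)"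
    by metis
  define cs where "cs = concat (map (\<lambda>i. map cmod (as i)) [0..<m+1])"
  have "real (length cs) = (\<Sum>i<m+1. real (length (as i)))"
    by (simp add: cs_def length_concat o_def interv_sum_list_conv_sum_set_nat atLeast0LessThan del: upt_Suc)
  also have "\<dots> \<le> (\<Sum>i<m+1. P * X)" using as by (intro sum_mono) auto
  finally have csl: "real (length cs) \<le> Y" by (simp add: Y_def algebra_simps)
  define \<eta> where "\<eta> = \<delta> / (2 * (length cs + 1))"
  have \<eta>: "\<eta> > 0" using \<delta> by (simp add: \<eta>_def)
  obtain r where r: "\<rho> \<le> r" "r \<le> \<rho> + \<delta>" "\<And>c. c \<in> set cs \<Longrightarrow> \<eta> \<le> \<bar>r - c\<bar>"
    using real_far_from_list[OF \<delta>, of \<rho> cs] unfolding \<eta>_def by blast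
  show thesis
  proof (rule that[OF r(1,2)])
    fix i z assume i: "i \<le> m" and z: "cmod z = r"
    have "\<eta> \<le> cmod (z - a)" if "a \<in> set (as i)" for a
    proof -
      have "cmod a \<in> set cs" using that i by (auto simp: cs_def simp del: upt_Suc)
      hence "\<eta> \<le> \<bar>cmod z - cmod a\<bar>" using r z by auto
      also have "\<dots> \<le> cmod (z - a)" by (rule norm_triangle_ineq3)
      finally show ?thesis .
    qed
    moreover have "cmod z \<le> \<rho> + \<delta>" using z r by simp
    ultimately have *: "G i z \<noteq> 0" "cmod (deriv (G i) z / G i z)
      \<le> length (as i) / \<eta> + length (as i) / \<delta> + 8 * (\<rho> + 3 * \<delta>) / \<delta>\<^sup>2 * P" using as[OF i] \<eta> by blast+
    have l: "real (length (as i)) \<le> Y" using as[OF i] YPX by linarith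
    have "length (as i) / \<eta> = real (length (as i)) * (2 * (real (length cs) + 1)) / \<delta>"
      by (simp add: \<eta>_def algebra_simps)
    also have "\<dots> \<le> Y * (2 * (Y + 1)) / \<delta>"
      by (intro divide_right_mono mult_mono add_mono order_refl l csl) (use \<delta> Y in auto)
    finally have 1: "length (as i) / \<eta> \<le> Y * (2 * (Y + 1)) / \<delta>" .
    have 2: "length (as i) / \<delta> \<le> Y / \<delta>" using l \<delta> by (intro divide_right_mono) auto
    have "8 * (\<rho> + 3 * \<delta>) / \<delta>\<^sup>2 * P = 8 * (P * X) / \<delta>" using \<delta> by (simp add: X_def power2_eq_square)
    also have "\<dots> \<le> 8 * Y / \<delta>" using YPX \<delta> by (intro divide_right_mono) auto
    finally have 3: "8 * (\<rho> + 3 * \<delta>) / \<delta>\<^sup>2 * P \<le> 8 * Y / \<delta>" .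
    have "Y * (2 * (Y + 1)) / \<delta> + Y / \<delta> + 8 * Y / \<delta> = (2 * Y\<^sup>2 + 11 * Y) / \<delta>"
      by (simp add: add_divide_distrib algebra_simps power2_eq_square)
    also have "\<dots> \<le> 13 * Y\<^sup>2 / \<delta>"
      using Y \<delta> mult_left_mono[OF Y, of Y] by (intro divide_right_mono) (auto simp: power2_eq_square)
    finally show "G i z \<noteq> 0 \<and> cmod (deriv (G i) z / G i z) \<le> 13 * ((real m + 1) * P * ((\<rho> + 3 * \<delta>) / \<delta>))\<^sup>2 / \<delta>"
      using * 1 2 3 unfolding Y_def[symmetric, unfolded X_def] by linarith
  qed
qed

section \<open>Quotients, growth and removable singularities\<close>

text \<open>If \<open>F\<close> is a quotient of entire functions bounded by \<open>exp S\<close>, its size exceeds \<open>exp S\<close> only through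
the small values of the denominator \<open>\<psi>\<close>.  Moving the zeros of \<open>\<psi>\<close> into Blaschke factors, which have
modulus one on the circle, leaves a zero-free denominator \<open>H\<close>, and Harnack's inequality bounds it
from below.\<close>

lemma entire_quotient_bound:
  assumes F: "F holomorphic_on UNIV" and \<psi>: "\<psi> holomorphic_on UNIV" and \<psi>0: "\<psi> 0 \<noteq> 0"
    and pos: "0 < \<rho>" "0 < \<delta>" and r: "\<rho> + \<delta> < r"
    and bd: "\<And>z. cmod z = r \<Longrightarrow> cmod (\<psi> z) \<le> exp S" "\<And>z. cmod z = r \<Longrightarrow> cmod (F z * \<psi> z) \<le> exp S"
    and z: "cmod z \<le> \<rho>"
  shows "cmod (F z) \<le> exp (2 * (\<rho> + \<delta>) / \<delta> * (S + 1 - ln (cmod (\<psi> 0))))"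
proof -
  have r0: "0 < r" "0 < \<rho> + \<delta>" using r pos by auto
  have bd': "cmod (\<psi> w) \<le> exp S" if "cmod w \<le> r" for w
    by (rule entire_bound_from_circle[OF \<psi> r0(1) bd(1) that])
  obtain as H where H: "H holomorphic_on UNIV" and as: "\<And>a. a \<in> set as \<Longrightarrow> cmod a \<le> \<rho> + \<delta>"
    and eq: "\<And>z. \<psi> z * blaschke_den r as z = H z * blaschke_num as z"
    and Hb: "\<And>z. cmod z \<le> r \<Longrightarrow> cmod (H z) \<le> exp S" and Hnz: "\<And>z. cmod z \<le> \<rho> + \<delta> \<Longrightarrow> H z \<noteq> 0"
    and H0: "cmod (\<psi> 0) \<le> cmod (H 0)" and len: "length as * ln (r / (\<rho> + \<delta>)) \<le> S - ln (cmod (\<psi> 0))"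
    by (rule blaschke_factorization[OF \<psi> \<psi>0 r0(2) r bd']) (assumption, rule that)
  have FH: "cmod (F w * H w) \<le> exp S" if w: "cmod w = r" for w
  proof -
    have nz: "blaschke_num as w \<noteq> 0"
      using as w r by (force simp: blaschke_num_def prod_list_zero_iff)
    have "cmod (F w * H w) * cmod (blaschke_num as w) = cmod (F w * \<psi> w) * cmod (blaschke_den r as w)"
      using eq[of w] by (simp add: mult.assoc flip: norm_mult)
    moreover have "cmod (blaschke_den r as w) = cmod (blaschke_num as w)" "cmod (blaschke_num as w) > 0"
      using blaschke_eq_on_circle[OF r0(1) w, of as] nz by auto
    ultimately show ?thesis using bd(2)[OF w] by simp
  qed
  have zr: "cmod z \<le> r" using z r pos by simp
  have FHz: "cmod (F z * H z) \<le> exp S"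
    by (rule entire_bound_from_circle[of "\<lambda>w. F w * H w", OF _ r0(1) FH zr]) (intro holomorphic_intros F H)
  have Hz: "H z \<noteq> 0" using Hnz[of z] z pos by simp
  have "S + 1 - ln (cmod (H z)) \<le> 2 * (\<rho> + \<delta>) / ((\<rho> + \<delta>) - cmod z) * (S + 1 - ln (cmod (H 0)))"
  proof (rule zero_free_bounds(1))
    show "cmod (H w) < exp (S + 1)" if "w \<in> ball 0 (\<rho> + \<delta>)" for w
      using Hb[of w] that r by (smt (verit) dist_0_norm exp_less_mono mem_ball)
  qed (use H Hnz z pos in \<open>auto intro: holomorphic_on_subset\<close>)
  also have "\<dots> \<le> 2 * (\<rho> + \<delta>) / \<delta> * (S + 1 - ln (cmod (\<psi> 0)))"
  proof (rule mult_mono)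
    show "2 * (\<rho> + \<delta>) / ((\<rho> + \<delta>) - cmod z) \<le> 2 * (\<rho> + \<delta>) / \<delta>"
      using pos z by (intro frac_le) auto
    have "ln (cmod (\<psi> 0)) \<le> ln (cmod (H 0))" using H0 \<psi>0 Hnz[of 0] r0 by (subst ln_le_cancel_iff) auto
    thus "S + 1 - ln (cmod (H 0)) \<le> S + 1 - ln (cmod (\<psi> 0))" by linarith
    have "cmod (H 0) \<le> exp S" using Hb[of 0] r0 by simp
    hence "ln (cmod (H 0)) \<le> ln (exp S)" using Hnz[of 0] r0 by (subst ln_le_cancel_iff) auto
    thus "0 \<le> S + 1 - ln (cmod (H 0))" by simp
  qed (use pos in auto)
  finally have *: "S - ln (cmod (H z)) \<le> 2 * (\<rho> + \<delta>) / \<delta> * (S + 1 - ln (cmod (\<psi> 0)))" by linarith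
  have "cmod (F z) \<le> exp S / cmod (H z)" using FHz Hz by (simp add: norm_mult field_simps)
  also have "\<dots> = exp (S - ln (cmod (H z)))" using Hz by (simp add: exp_diff)
  also have "\<dots> \<le> exp (2 * (\<rho> + \<delta>) / \<delta> * (S + 1 - ln (cmod (\<psi> 0))))" using * by simp
  finally show ?thesis .
qed

text \<open>Borel's growth argument.  With \<open>b = 1 + ln A\<close> and \<open>\<delta> = \<rho> / b(\<rho>)\<^sup>2\<close>, the hypothesis says that
\<open>b\<close> gains at least one between \<open>\<rho>\<close> and \<open>\<rho> + \<delta>\<close> once it is large, since otherwise \<open>exp (b - 1)\<close> would
be bounded by a power of \<open>b\<close>.  Iterating, \<open>b\<close> grows to infinity along radii whose
successive quotients are at most \<open>1 + 1 / (n + 2)\<^sup>2\<close>, hence on a bounded interval: impossible for a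
monotone function.\<close>

lemma bounded_if_slow_self_growth:
  fixes A :: "real \<Rightarrow> real"
  assumes mono: "\<And>x y. 1 \<le> x \<Longrightarrow> x \<le> y \<Longrightarrow> A x \<le> A y" and A1: "\<And>x. 1 \<le> x \<Longrightarrow> 1 \<le> A x"
    and bd: "\<And>\<rho> \<delta>. 1 \<le> \<rho> \<Longrightarrow> 0 < \<delta> \<Longrightarrow>
       A \<rho> \<le> C * ((\<rho> + \<delta>) / \<delta>) * (1 + ln (A (\<rho> + \<delta>)) + ln ((\<rho> + \<delta>) / \<delta>))"
  shows "\<exists>B. \<forall>\<rho>\<ge>1. A \<rho> \<le> B"
proof (rule ccontr)
  assume unb: "\<not> ?thesis"
  define b where "b \<rho> = 1 + ln (A \<rho>)" for \<rho>
  have b1: "b x \<ge> 1" if "1 \<le> x" for x using A1[OF that] by (simp add: b_def)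
  have bmono: "b x \<le> b y" if "1 \<le> x" "x \<le> y" for x y
    using mono[OF that] A1[OF that(1)] by (simp add: b_def)
  define D where "D = \<bar>C\<bar> + 1"
  have "eventually (\<lambda>t. D * (t\<^sup>2 + 1) * ((t + 1) + ln (t\<^sup>2 + 1)) < exp (t - 1)) at_top"
    by real_asymp
  then obtain t0 where t0: "\<And>t. t \<ge> t0 \<Longrightarrow> D * (t\<^sup>2 + 1) * ((t + 1) + ln (t\<^sup>2 + 1)) < exp (t - 1)"
    by (auto simp: eventually_at_top_linorder)
  \<comment> \<open>The lower bound \<open>2\<close> makes the increments telescope: \<open>1 / (n + 2)\<^sup>2 \<le> 1 / (n + 1) - 1 / (n + 2)\<close>.\<close>
  define b0 where "b0 = max 2 t0"
  have step: "b x + 1 \<le> b (x * (1 + 1 / (b x)\<^sup>2))" if x: "1 \<le> x" "b0 \<le> b x" for x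
  proof (rule ccontr)
    assume neg: "\<not> ?thesis"
    define \<delta> where "\<delta> = x / (b x)\<^sup>2"
    have bx: "b x \<ge> 2" "b x \<ge> t0" using x by (auto simp: b0_def)
    have \<delta>: "\<delta> > 0" using x bx by (simp add: \<delta>_def)
    have R: "x * (1 + 1 / (b x)\<^sup>2) = x + \<delta>" by (simp add: \<delta>_def algebra_simps)
    have X: "(x + \<delta>) / \<delta> = (b x)\<^sup>2 + 1" using x bx by (simp add: \<delta>_def field_simps)
    have lnX: "ln ((b x)\<^sup>2 + 1) \<ge> 0" by simp
    have bR: "b (x + \<delta>) \<ge> 1" using b1 x \<delta> by simp
    have "exp (b x - 1) = A x" using A1[OF x(1)] by (simp add: b_def)
    also have "\<dots> \<le> C * ((b x)\<^sup>2 + 1) * (b (x + \<delta>) + ln ((b x)\<^sup>2 + 1))"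
      using bd[OF x(1) \<delta>] unfolding X b_def by simp
    also have "\<dots> \<le> D * ((b x)\<^sup>2 + 1) * ((b x + 1) + ln ((b x)\<^sup>2 + 1))"
      using neg R bR lnX by (intro mult_mono) (auto simp: D_def)
    also have "\<dots> < exp (b x - 1)" using t0 bx by simp
    finally show False by simp
  qed
  have "\<exists>x\<ge>1. b0 \<le> b x"
  proof (rule ccontr)
    assume *: "\<not> ?thesis"
    have "A x \<le> exp b0" if "1 \<le> x" for x
    proof -
      have "ln (A x) \<le> b0" using * that by (fastforce simp: b_def not_le)
      thus ?thesis using A1[OF that] by (metis exp_le_cancel_iff exp_ln less_le_trans zero_less_one)
    qed
    thus False using unb by blast
  qed
  then obtain x0 where x0: "1 \<le> x0" "b0 \<le> b x0" by blast
  define X where "X n = ((\<lambda>x. x * (1 + 1 / (b x)\<^sup>2)) ^^ n) x0" for n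
  have X_Suc: "X (Suc n) = X n * (1 + 1 / (b (X n))\<^sup>2)" for n by (simp add: X_def)
  have inv: "1 \<le> X n \<and> b0 + n \<le> b (X n) \<and> X n \<le> x0 * exp (1 - 1 / (real n + 1))" for n
  proof (induction n)
    case 0
    thus ?case using x0 by (simp add: X_def)
  next
    case (Suc n)
    have "b0 \<ge> 2" by (simp add: b0_def)
    hence bn: "b (X n) \<ge> 2 + real n" using Suc by linarith
    have "b (X n) + 1 \<le> b (X (Suc n))" unfolding X_Suc using Suc by (intro step) auto
    hence 1: "b0 + Suc n \<le> b (X (Suc n))" using Suc by simp
    have "X n * 1 \<le> X (Suc n)" unfolding X_Suc using Suc by (intro mult_left_mono) auto
    hence 2: "1 \<le> X (Suc n)" using Suc by simp
    have "1 / (b (X n))\<^sup>2 \<le> 1 / ((real n + 1) * (real n + 2))"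
      unfolding power2_eq_square using bn by (intro frac_le mult_mono mult_pos_pos) auto
    also have "\<dots> = 1 / (real n + 1) - 1 / (real (Suc n) + 1)" by (simp add: divide_simps)
    finally have "1 + 1 / (b (X n))\<^sup>2 \<le> 1 + (1 / (real n + 1) - 1 / (real (Suc n) + 1))" by simp
    also have "\<dots> \<le> exp (1 / (real n + 1) - 1 / (real (Suc n) + 1))" by (rule exp_ge_add_one_self)
    finally have "X (Suc n) \<le> (x0 * exp (1 - 1 / (real n + 1))) * exp (1 / (real n + 1) - 1 / (real (Suc n) + 1))"
      unfolding X_Suc using Suc x0 by (intro mult_mono) auto
    also have "\<dots> = x0 * exp (1 - 1 / (real (Suc n) + 1))" by (simp add: mult.assoc flip: exp_add)
    finally show ?case using 1 2 by simp
  qed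
  have "real n \<le> b (x0 * exp 1)" for n
  proof -
    have "X n \<le> x0 * exp (1 - 1 / (real n + 1))" using inv by blast
    also have "\<dots> \<le> x0 * exp 1" using x0 by (intro mult_left_mono) auto
    finally have "b (X n) \<le> b (x0 * exp 1)" using inv by (intro bmono) auto
    moreover have "b0 + real n \<le> b (X n)" "b0 \<ge> 2" using inv by (auto simp: b0_def)
    ultimately show ?thesis by linarith
  qed
  thus False using reals_Archimedean2 not_less by blast
qed

lemma common_nonzero_point:
  assumes "finite I" "\<And>i. i \<in> I \<Longrightarrow> G i holomorphic_on UNIV \<and> (\<exists>z. G i z \<noteq> (0::complex))"
  shows "\<exists>z. \<forall>i\<in>I. G i z \<noteq> 0"
proof -
  have "countable {z\<in>UNIV. G i z = 0}" if "i \<in> I" for i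
  proof (cases "G i constant_on UNIV")
    case True
    hence "{z\<in>UNIV. G i z = 0} = {}" using assms(2)[OF that] by (auto simp: constant_on_def)
    thus ?thesis by simp
  next
    case False
    thus ?thesis using assms(2)[OF that]
      by (intro holomorphic_countable_zeros) auto
  qed
  hence "countable (\<Union>i\<in>I. {z\<in>UNIV. G i z = 0})" using assms(1) by (intro countable_UN) (auto simp: countable_finite)
  moreover have "uncountable (UNIV :: complex set)" by (rule uncountable_UNIV_complex)
  ultimately have "(\<Union>i\<in>I. {z\<in>UNIV. G i z = 0}) \<noteq> UNIV" by metis
  thus ?thesis by auto
qed

text \<open>The poles of \<open>U' / U\<close> are simple, so multiplication by a function that vanishes at the zeros of \<open>U\<close>
removes them.\<close>

lemma mult_log_deriv_entire:
  assumes U: "U holomorphic_on UNIV" "\<exists>z. U z \<noteq> 0" and V: "V holomorphic_on UNIV"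
    and UV: "\<And>z. U z = 0 \<Longrightarrow> V z = (0::complex)"
  obtains \<kappa> where "\<kappa> holomorphic_on UNIV" "\<And>z. \<kappa> z * U z = V z * deriv U z"
proof -
  have "\<exists>r>0. \<exists>c. c holomorphic_on ball a r \<and> (\<forall>w\<in>ball a r. w \<noteq> a \<longrightarrow> U w \<noteq> 0) \<and> (\<forall>w\<in>ball a r. c w * U w = V w * deriv U w)"
    if a: "U a = 0" for a
  proof -
    have nc: "\<not> U constant_on UNIV" using U(2) a by (metis UNIV_I constant_on_def)
    obtain g r n where g: "0 < n" "0 < r" "g holomorphic_on ball a r"
      "\<And>w. w \<in> ball a r \<Longrightarrow> U w = (w - a) ^ n * g w" "\<And>w. w \<in> ball a r \<Longrightarrow> g w \<noteq> 0"
      using holomorphic_factor_zero_nonconstant[OF U(1) open_UNIV connected_UNIV UNIV_I a nc] by metis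
    obtain V1 where V1: "V1 holomorphic_on UNIV" "\<And>z. V z = (z - a) * V1 z"
      using divide_out_zero[OF V] UV[OF a] by blast
    define c where "c w = V1 w * (of_nat n * g w + (w - a) * deriv g w) / g w" for w
    have dU: "deriv U w = of_nat n * (w - a) ^ (n - 1) * g w + (w - a) ^ n * deriv g w" if w: "w \<in> ball a r" for w
    proof (rule DERIV_imp_deriv, rule has_field_derivative_transform_within_open[OF _ open_ball w])
      show "((\<lambda>w. (w - a) ^ n * g w) has_field_derivative
          (of_nat n * (w - a) ^ (n - 1) * g w + (w - a) ^ n * deriv g w)) (at w)"
        by (auto intro!: derivative_eq_intros holomorphic_derivI[OF g(3) open_ball w])
    qed (use g in auto)
    have "c w * U w = V w * deriv U w" if w: "w \<in> ball a r" for w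
    proof -
      have pw: "(w - a) ^ n = (w - a) * (w - a) ^ (n - 1)" using g(1) by (metis power_eq_if less_not_refl3)
      have "c w * U w = V1 w * (of_nat n * g w + (w - a) * deriv g w) * (w - a) ^ n"
        using g(4,5)[OF w] by (simp add: c_def)
      also have "\<dots> = V w * deriv U w" unfolding dU[OF w] V1(2) pw by (simp add: algebra_simps)
      finally show ?thesis .
    qed
    moreover have "c holomorphic_on ball a r" unfolding c_def
      using g V1 by (intro holomorphic_intros) (auto intro: holomorphic_on_subset)
    ultimately show ?thesis using g by (intro exI[of _ r] conjI exI[of _ c]) auto
  qed
  then obtain r c where rc: "\<And>a. U a = 0 \<Longrightarrow> r a > 0 \<and> c a holomorphic_on ball a (r a) \<and>
    (\<forall>w\<in>ball a (r a). w \<noteq> a \<longrightarrow> U w \<noteq> 0) \<and> (\<forall>w\<in>ball a (r a). c a w * U w = V w * deriv U w)" by metis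
  define \<kappa> where "\<kappa> z = (if U z = 0 then c z z else V z * deriv U z / U z)" for z
  have "\<kappa> field_differentiable at a" for a
  proof (cases "U a = 0")
    case True
    have ab: "a \<in> ball a (r a)" using rc[OF True] by simp
    have "c a field_differentiable at a"
      using rc[OF True] ab by (meson holomorphic_on_imp_differentiable_at open_ball)
    moreover have "c a w = \<kappa> w" if "w \<in> ball a (r a)" for w
    proof (cases "w = a")
      case False
      hence "U w \<noteq> 0" "c a w * U w = V w * deriv U w" using rc[OF True] that by auto
      thus ?thesis by (simp add: \<kappa>_def field_simps)
    qed (simp add: \<kappa>_def True)
    ultimately show ?thesis
      unfolding field_differentiable_def
      using has_field_derivative_transform_within_open[OF _ open_ball ab, of "c a" _ \<kappa>] by metis
  next
    case False
    have op: "open {z. U z \<noteq> 0}"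
      using open_Collect_neq[of U "\<lambda>_. 0"] U(1) by (simp add: holomorphic_on_imp_continuous_on)
    have "(\<lambda>z. V z * deriv U z / U z) holomorphic_on {z. U z \<noteq> 0}"
      using U V by (intro holomorphic_intros holomorphic_deriv) (auto intro: holomorphic_on_subset op)
    hence "(\<lambda>z. V z * deriv U z / U z) field_differentiable at a"
      by (rule holomorphic_on_imp_differentiable_at[OF _ op]) (simp add: False)
    moreover have "V z * deriv U z / U z = \<kappa> z" if "z \<in> {z. U z \<noteq> 0}" for z using that by (simp add: \<kappa>_def)
    moreover have "a \<in> {z. U z \<noteq> 0}" using False by simp
    ultimately show ?thesis
      unfolding field_differentiable_def
      using has_field_derivative_transform_within_open[OF _ op, of "\<lambda>z. V z * deriv U z / U z" _ a \<kappa>] by metis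
  qed
  hence "\<kappa> holomorphic_on UNIV" by (simp add: holomorphic_on_def)
  moreover have "\<kappa> z * U z = V z * deriv U z" for z using UV by (simp add: \<kappa>_def)
  ultimately show thesis by (rule that)
qed

section \<open>The auxiliary entire functions\<close>

lemma entire_higher_deriv: "f holomorphic_on UNIV \<Longrightarrow> (deriv ^^ j) f holomorphic_on UNIV"
  by (rule holomorphic_higher_deriv) auto

lemma DERIV_entire: "f holomorphic_on UNIV \<Longrightarrow> (f has_field_derivative deriv f z) (at z)"
  by (rule holomorphic_derivI) auto

lemma higher_deriv_power_divisible:
  assumes g: "g holomorphic_on UNIV" and "j \<le> n"
  shows "\<exists>W. W holomorphic_on UNIV \<and> (\<forall>z. (deriv ^^ j) (\<lambda>z. g z ^ n) z = g z ^ (n - j) * W z)"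
  using assms(2)
proof (induction j)
  case 0
  show ?case by (intro exI[of _ "\<lambda>_. 1"]) auto
next
  case (Suc j)
  then obtain W where W: "W holomorphic_on UNIV" "\<And>z. (deriv ^^ j) (\<lambda>z. g z ^ n) z = g z ^ (n - j) * W z" by auto
  define m where "m = n - Suc j"
  have m: "n - j = Suc m" using Suc by (simp add: m_def)
  have "(deriv ^^ j) (\<lambda>z. g z ^ n) = (\<lambda>z. g z ^ Suc m * W z)" using W(2) by (auto simp: m)
  moreover have "((\<lambda>z. g z ^ Suc m * W z) has_field_derivative
      g z ^ m * (of_nat (Suc m) * deriv g z * W z + g z * deriv W z)) (at z)" for z
  proof -
    have "((\<lambda>z. g z ^ Suc m * W z) has_field_derivative
        of_nat (Suc m) * (deriv g z * g z ^ m) * W z + deriv W z * g z ^ Suc m) (at z)"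
      using DERIV_mult[OF DERIV_power[OF DERIV_entire[OF g, of z], of "Suc m"] DERIV_entire[OF W(1), of z]]
      by (simp only: diff_Suc_Suc diff_zero)
    thus ?thesis by (rule DERIV_cong) (simp only: power_Suc algebra_simps)
  qed
  ultimately have "(deriv ^^ Suc j) (\<lambda>z. g z ^ n) z = g z ^ m * (of_nat (Suc m) * deriv g z * W z + g z * deriv W z)" for z
    by (simp add: DERIV_imp_deriv)
  moreover have "(\<lambda>z. of_nat (Suc m) * deriv g z * W z + g z * deriv W z) holomorphic_on UNIV"
    using g W by (intro holomorphic_intros) auto
  ultimately show ?case by (auto simp: m_def)
qed

text \<open>With \<open>K = g\<^bsup>n-k\<^esup> W\<close> the \<open>k\<close>-th derivative of \<open>F\<close>, the function \<open>V = W - g\<^sup>k\<close> vanishes where \<open>F = 1\<close>,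
because \<open>g\<close> does not vanish there.  So \<open>V F' / (F - 1)\<close> is entire, and since \<open>g\<close> has no common zero with
\<open>F - 1\<close>, so is \<open>\<kappa> = n g' V / (F - 1)\<close>.  Then \<open>\<phi>\<close> and \<open>\<psi>\<close> are products of powers of \<open>g\<close> and \<open>\<kappa>\<close>; the
exponents are non-negative precisely for \<open>n \<ge> k + 2\<close>.\<close>

lemma auxiliary_entire_functions:
  assumes g: "g holomorphic_on UNIV" and kn: "n \<ge> k + 2" and F: "F = (\<lambda>z. g z ^ n)"
    and share: "\<And>z. F z = 1 \<Longrightarrow> (deriv ^^ k) F z = 1" and F1: "\<exists>z. F z \<noteq> 1"
  obtains \<phi> \<psi> where "\<phi> holomorphic_on UNIV" "\<psi> holomorphic_on UNIV"
    "\<And>z. \<phi> z * (F z * (F z - 1)) = deriv F z * ((deriv ^^ k) F z - F z)"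
    "\<And>z. \<psi> z * F z = \<phi> z ^ (k + 2)"
proof -
  obtain W where W: "W holomorphic_on UNIV" "\<And>z. (deriv ^^ k) F z = g z ^ (n - k) * W z"
    using higher_deriv_power_divisible[OF g, of k n] kn F by auto
  define U V where "U z = F z - 1" and "V z = W z - g z ^ k" for z
  have Fh: "F holomorphic_on UNIV" unfolding F by (intro holomorphic_intros g)
  have dF: "deriv F z = of_nat n * g z ^ (n - 1) * deriv g z" for z
    unfolding F by (rule DERIV_imp_deriv) (auto intro!: derivative_eq_intros DERIV_entire g)
  have nk: "g z ^ n = g z ^ (n - k) * g z ^ k" for z using kn by (simp flip: power_add)
  have gn1: "g z ^ n = g z ^ (n - 1) * g z" for z using kn by (simp flip: power_Suc2)
  have Uh: "U holomorphic_on UNIV" and Vh: "V holomorphic_on UNIV"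
    unfolding U_def V_def by (intro holomorphic_intros Fh W g)+
  have UV: "V z = 0" if "U z = 0" for z
  proof -
    have gz: "g z ^ n = 1" using that by (simp add: U_def F)
    hence "g z \<noteq> 0" using kn by (cases "g z = 0") (auto simp: power_0_left)
    moreover have "g z ^ (n - k) * W z = 1" using share[of z] gz W(2) by (simp add: F)
    hence "g z ^ (n - k) * W z = g z ^ (n - k) * g z ^ k" using nk[of z] gz by simp
    ultimately show ?thesis by (simp add: V_def)
  qed
  have dU: "deriv U z = deriv F z" for z unfolding U_def
    by (rule DERIV_imp_deriv) (auto intro!: derivative_eq_intros DERIV_entire Fh)
  obtain \<kappa>\<^sub>1 where k1: "\<kappa>\<^sub>1 holomorphic_on UNIV" "\<And>z. \<kappa>\<^sub>1 z * U z = V z * deriv U z"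
    using mult_log_deriv_entire[OF Uh _ Vh UV] F1 by (auto simp: U_def)
  \<comment> \<open>As \<open>1 = g\<^sup>n - U\<close>, one has \<open>n g' V = g V U' - n g' V U\<close>, and \<open>V U'\<close> is divisible by \<open>U\<close>.\<close>
  define \<kappa> where "\<kappa> z = g z * \<kappa>\<^sub>1 z - of_nat n * deriv g z * V z" for z
  have \<kappa>h: "\<kappa> holomorphic_on UNIV" unfolding \<kappa>_def using g k1 Vh by (intro holomorphic_intros) auto
  have \<kappa>U: "\<kappa> z * U z = of_nat n * deriv g z * V z" for z
  proof -
    have "\<kappa> z * U z = g z * (V z * deriv F z) - of_nat n * deriv g z * V z * U z"
      using k1(2)[of z] by (simp add: \<kappa>_def dU algebra_simps)
    also have "g z * (V z * deriv F z) = of_nat n * deriv g z * V z * g z ^ n"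
      unfolding dF gn1 by (simp add: algebra_simps)
    finally show ?thesis by (simp add: U_def F algebra_simps)
  qed
  define d where "d = n - k - 2"
  have n: "n = k + 2 + d" using kn by (simp add: d_def)
  define \<phi> \<psi> where "\<phi> z = g z ^ (d + 1) * \<kappa> z" and "\<psi> z = g z ^ ((k + 1) * d) * \<kappa> z ^ (k + 2)" for z
  show thesis
  proof (rule that[of \<phi> \<psi>])
    show "\<phi> holomorphic_on UNIV" "\<psi> holomorphic_on UNIV"
      unfolding \<phi>_def \<psi>_def by (intro holomorphic_intros g \<kappa>h)+
    show "\<psi> z * F z = \<phi> z ^ (k + 2)" for z
      by (simp add: \<phi>_def \<psi>_def F n power_mult_distrib flip: power_mult power_add)
         (simp add: algebra_simps power_add power2_eq_square flip: power_mult)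
    show "\<phi> z * (F z * (F z - 1)) = deriv F z * ((deriv ^^ k) F z - F z)" for z
    proof -
      have "\<phi> z * (F z * (F z - 1)) = g z ^ (d + 1) * g z ^ n * (\<kappa> z * U z)" by (simp add: \<phi>_def U_def F)
      also have "\<dots> = g z ^ (d + 1) * g z ^ n * (of_nat n * deriv g z * V z)" by (simp add: \<kappa>U)
      also have "g z ^ (d + 1) * g z ^ n = g z ^ (n - 1) * g z ^ (n - k)"
        by (simp add: n flip: power_add)
      also have "g z ^ (n - 1) * g z ^ (n - k) * (of_nat n * deriv g z * V z)
          = deriv F z * (g z ^ (n - k) * V z)" by (simp add: dF)
      also have "g z ^ (n - k) * V z = (deriv ^^ k) F z - F z" 
        using W(2)[of z] nk[of z] by (simp add: V_def F right_diff_distrib)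
      finally show ?thesis .
    qed
  qed
qed

text \<open>The main estimate.  The non-vanishing assumptions at \<open>0\<close> normalize the functions whose zeros are
counted, and \<open>\<psi>\<close>; they will be achieved by a translation.\<close>

lemma bounded_if_auxiliary:
  assumes F: "F holomorphic_on UNIV" and \<phi>: "\<phi> holomorphic_on UNIV" and \<psi>: "\<psi> holomorphic_on UNIV"
    and k: "0 < k"
    and eq1: "\<And>z. \<phi> z * (F z * (F z - 1)) = deriv F z * ((deriv ^^ k) F z - F z)"
    and eq2: "\<And>z. \<psi> z * F z = \<phi> z ^ (k + 2)"
    and nz: "\<And>j. j \<le> k \<Longrightarrow> (deriv ^^ j) F 0 \<noteq> 0" and F1: "F 0 \<noteq> 1" and Fk: "(deriv ^^ k) F 0 \<noteq> F 0"
  shows "bounded (range F)"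
proof -
  define M where "M \<rho> = (SUP z\<in>cball 0 \<rho>. cmod (F z))" for \<rho>
  define A where "A \<rho> = ln (3 + M \<rho>)" for \<rho>
  have bdd: "bdd_above ((\<lambda>z. cmod (F z)) ` cball 0 \<rho>)" for \<rho>
    using F by (intro bounded_imp_bdd_above compact_imp_bounded compact_continuous_image continuous_intros)
      (auto intro: holomorphic_on_imp_continuous_on holomorphic_on_subset)
  have Mge: "cmod (F z) \<le> M \<rho>" if "cmod z \<le> \<rho>" for z \<rho>
    unfolding M_def by (rule cSUP_upper[OF _ bdd]) (use that in auto)
  have Mle: "M \<rho> \<le> B" if "\<rho> \<ge> 0" "\<And>z. cmod z \<le> \<rho> \<Longrightarrow> cmod (F z) \<le> B" for \<rho> B
    unfolding M_def by (rule cSUP_least) (use that in auto)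
  have M0: "M \<rho> \<ge> 0" if "\<rho> \<ge> 0" for \<rho> using Mge[of 0 \<rho>] that by (smt (verit) norm_ge_zero norm_zero)
  have Mmono: "M x \<le> M y" if "0 \<le> x" "x \<le> y" for x y by (rule Mle) (use that Mge in auto)
  have A1: "1 \<le> A x" if "1 \<le> x" for x
  proof -
    have "exp 1 \<le> (3::real)" by (rule exp_le)
    hence "ln (exp 1) \<le> ln (3 + M x)" using M0[of x] that by (subst ln_le_cancel_iff) auto
    thus ?thesis by (simp add: A_def)
  qed
  have Amono: "A x \<le> A y" if "1 \<le> x" "x \<le> y" for x y
    using Mmono[of x y] M0[of x] that by (simp add: A_def)
  have expA: "exp (A x) = 3 + M x" if "0 \<le> x" for x using M0[OF that] by (simp add: A_def)
  have dF0: "deriv F 0 \<noteq> 0" using nz[of 1] k by simp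
  have "\<phi> 0 \<noteq> 0" using eq1[of 0] dF0 Fk by auto
  hence \<psi>0: "\<psi> 0 \<noteq> 0" using eq2[of 0] by auto
  \<comment> \<open>The functions whose logarithmic derivatives make up \<open>\<phi>\<close> and \<open>\<phi> / F\<close>.\<close>
  define G where "G i = (if i = k then (\<lambda>z. F z - 1) else (deriv ^^ i) F)" for i
  have Gh: "G i holomorphic_on UNIV" for i
    unfolding G_def using F entire_higher_deriv by (auto intro!: holomorphic_intros)
  have G0: "G i 0 \<noteq> 0" if "i \<le> k" for i using nz that F1 by (auto simp: G_def)
  define L where "L = (\<Sum>i\<le>k. \<bar>ln (cmod (G i 0))\<bar>)"
  have Lge: "- ln (cmod (G i 0)) \<le> L" if "i \<le> k" for i
  proof -
    have "\<bar>ln (cmod (G i 0))\<bar> \<le> L" unfolding L_def by (rule member_le_sum) (use that in auto)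
    thus ?thesis by linarith
  qed
  have L0: "L \<ge> 0" unfolding L_def by (rule sum_nonneg) auto
  \<comment> \<open>The constants \<open>C0\<close> to \<open>C4\<close> and \<open>c\<close> depend on \<open>k\<close>, \<open>F\<close> and \<open>\<psi>\<close> only, not on the radii.\<close>
  define C0 where "C0 = ln (fact k) + k * ln 6 + 1 + L"
  have C0: "C0 \<ge> 1" using L0 by (simp add: C0_def)
  define C1 where "C1 = 1 + C0 + k"
  define C2 where "C2 = 13 * 216 * (real k + 1)\<^sup>2 * C1\<^sup>2"
  have C1: "C1 \<ge> 1" using C0 by (simp add: C1_def)
  have C2: "C2 \<ge> 1"
  proof -
    have "1 * 1 * 1 \<le> (13 * 216) * (real k + 1)\<^sup>2 * C1\<^sup>2" using C1 by (intro mult_mono) (auto simp: one_le_power)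
    thus ?thesis by (simp add: C2_def)
  qed
  define c where "c = (real k + 2) * (real k + 1)"
  define C3 where "C3 = (k + 2) * ln 4 + c * ln C2 + 1 + \<bar>ln (cmod (\<psi> 0))\<bar>"
  define C4 where "C4 = C3 + 5 * c"
  have cC: "c \<ge> 0" "C3 \<ge> 0" using C2 by (auto simp: C3_def c_def)
  have main: "A \<rho> \<le> (2 + 12 * C4) * ((\<rho> + \<delta>) / \<delta>) * (1 + ln (A (\<rho> + \<delta>)) + ln ((\<rho> + \<delta>) / \<delta>))"
    if \<rho>: "1 \<le> \<rho>" and \<delta>: "0 < \<delta>" for \<rho> \<delta>
  proof -
    \<comment> \<open>Room for six steps between \<open>\<rho>\<close> and \<open>\<rho> + \<delta>\<close>: one for the quotient bound and one to keep the circle away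
        from it, three for the logarithmic derivatives, and one for Cauchy's inequality.\<close>
    define d where "d = \<delta> / 6"
    define R where "R = \<rho> + \<delta>"
    define X where "X = R / \<delta>"
    define a where "a = A R"
    have d: "d > 0" using \<delta> by (simp add: d_def)
    have R: "R \<ge> 1" using \<rho> \<delta> by (simp add: R_def)
    have X: "X \<ge> 1" using \<rho> \<delta> by (simp add: X_def R_def)
    have a: "a \<ge> 1" unfolding a_def by (rule A1[OF R])
    have aX: "a * X \<ge> 1" using mult_mono[OF a X] a by simp
    have invd: "1 / d \<le> 6 * X" using R \<delta> by (simp add: d_def X_def divide_right_mono)
    have FR: "cmod (F z) \<le> exp a - 3" if "cmod z \<le> R" for z
      using Mge[OF that] expA[of R] R by (simp add: a_def)
    define A' where "A' = a + ln (fact k) + k * ln (6 * X)"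
    have expA': "exp A' = exp a * fact k * (6 * X) ^ k"
      using X by (simp add: A'_def exp_add exp_of_nat_mult)
    have K1: "1 \<le> fact k * (6 * X) ^ k"
    proof -
      have "1 * 1 \<le> fact k * (6 * X) ^ k" using X by (intro mult_mono one_le_power fact_ge_1) auto
      thus ?thesis by simp
    qed
    have bd: "cmod (G i z) \<le> exp A'" if i: "i \<le> k" and z: "cmod z \<le> (\<rho> + 2 * d) + 3 * d" for i z
    proof (cases "i = k")
      case True
      have "cmod (F z - 1) \<le> cmod (F z) + 1" using norm_triangle_ineq4[of "F z" 1] by simp
      also have "\<dots> \<le> exp a * 1" using FR[of z] z d by (simp add: R_def d_def)
      also have "\<dots> \<le> exp a * (fact k * (6 * X) ^ k)" using K1 by (intro mult_left_mono) auto
      finally show ?thesis using True by (simp add: G_def expA' mult.assoc)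
    next
      case False
      have "cmod ((deriv ^^ i) F z) \<le> fact i * exp a / d ^ i"
      proof (rule Cauchy_inequality)
        fix x assume "cmod (z - x) = d"
        hence "cmod x \<le> R" using norm_triangle_ineq2[of x z] z by (simp add: R_def d_def norm_minus_commute)
        thus "cmod (F x) \<le> exp a" using FR[of x] by simp
      qed (use F d in \<open>auto intro: holomorphic_on_imp_continuous_on holomorphic_on_subset\<close>)
      also have "\<dots> = exp a * (fact i * (1 / d) ^ i)" by (simp add: power_divide)
      also have "\<dots> \<le> exp a * (fact k * (6 * X) ^ k)"
      proof (intro mult_left_mono mult_mono)
        have "(1 / d) ^ i \<le> (6 * X) ^ i" using invd d by (intro power_mono) auto
        also have "\<dots> \<le> (6 * X) ^ k" using X i by (intro power_increasing) auto
        finally show "(1 / d) ^ i \<le> (6 * X) ^ k" .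
      qed (use i d in \<open>auto intro: fact_mono\<close>)
      finally show ?thesis using False by (simp add: G_def expA' mult.assoc)
    qed
    define P where "P = a + C0 + k * ln X"
    have lnX: "0 \<le> ln X" "ln X \<le> X" using X by (auto intro: ln_bound)
    have P1: "1 \<le> P" using a C0 mult_nonneg_nonneg[of "real k" "ln X"] lnX unfolding P_def by linarith
    have PG: "A' + 1 - ln (cmod (G i 0)) \<le> P" if "i \<le> k" for i
      using Lge[OF that] X by (simp add: A'_def P_def C0_def ln_mult algebra_simps)
    obtain r where r: "\<rho> + 2 * d \<le> r" "r \<le> \<rho> + 2 * d + d"
      and rG: "\<And>i z. i \<le> k \<Longrightarrow> cmod z = r \<Longrightarrow> G i z \<noteq> 0 \<and>
        cmod (deriv (G i) z / G i z) \<le> 13 * ((real k + 1) * P * (((\<rho> + 2 * d) + 3 * d) / d))\<^sup>2 / d"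
      by (rule log_derivs_bounded_on_circle[of k G "\<rho> + 2 * d" d A' P])
         (use Gh G0 \<rho> d bd PG P1 in auto)
    \<comment> \<open>A common bound for the logarithmic derivatives on the circle; only its logarithm will matter.\<close>
    define \<Lambda> where "\<Lambda> = C2 * a\<^sup>2 * X ^ 5"
    have \<Lambda>1: "\<Lambda> \<ge> 1"
    proof -
      have "1 * 1 * 1 \<le> C2 * a\<^sup>2 * X ^ 5" using C2 a X by (intro mult_mono) (auto simp: one_le_power)
      thus ?thesis by (simp add: \<Lambda>_def)
    qed
    have "13 * ((real k + 1) * P * (((\<rho> + 2 * d) + 3 * d) / d))\<^sup>2 / d \<le> \<Lambda>"
    proof -
      have "a * 1 \<le> a * X" "C0 * 1 \<le> C0 * (a * X)" "real k * X \<le> real k * (a * X)"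
        using a X C0 aX by (intro mult_left_mono; simp)+
      moreover have "real k * ln X \<le> real k * X" using lnX by (intro mult_left_mono) auto
      ultimately have "P \<le> C1 * (a * X)" by (simp add: P_def C1_def algebra_simps)
      moreover have "((\<rho> + 2 * d) + 3 * d) / d \<le> 6 * X" using \<delta> by (simp add: d_def X_def R_def field_simps)
      ultimately have "((real k + 1) * P * (((\<rho> + 2 * d) + 3 * d) / d))\<^sup>2 \<le> ((real k + 1) * (C1 * (a * X)) * (6 * X))\<^sup>2"
        using P1 \<rho> d X by (intro power_mono mult_mono) auto
      hence "13 * ((real k + 1) * P * (((\<rho> + 2 * d) + 3 * d) / d))\<^sup>2 * (1 / d)
          \<le> 13 * ((real k + 1) * (C1 * (a * X)) * (6 * X))\<^sup>2 * (6 * X)"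
        using invd d by (intro mult_mono) auto
      also have "\<dots> = \<Lambda>" by (simp add: \<Lambda>_def C2_def power_mult_distrib power_numeral_reduce)
      finally show ?thesis by simp
    qed
    hence rL: "G i z \<noteq> 0 \<and> cmod (deriv (G i) z / G i z) \<le> \<Lambda>" if "i \<le> k" "cmod z = r" for i z
      using rG[OF that] by simp
    define Q where "Q = 4 * \<Lambda> ^ (k + 1)"
    define S where "S = (k + 2) * ln Q"
    have Q: "Q > 0" using \<Lambda>1 by (simp add: Q_def)
    have Qexp: "Q ^ (k + 2) = exp S" using Q by (simp only: S_def exp_of_nat_mult exp_ln)
    have on_circle: "cmod (\<psi> z) \<le> exp S \<and> cmod (F z * \<psi> z) \<le> exp S" if z: "cmod z = r" for z
    proof -
      have Fz: "F z \<noteq> 0" using rL[of 0 z] z k by (simp add: G_def)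
      have F1z: "F z - 1 \<noteq> 0" using rL[of k z] z by (simp add: G_def)
      have step: "cmod ((deriv ^^ Suc i) F z) \<le> \<Lambda> * cmod ((deriv ^^ i) F z)" if "i < k" for i
        using rL[of i z] z that by (auto simp: G_def norm_divide pos_divide_le_eq)
      have pw: "cmod ((deriv ^^ j) F z) \<le> \<Lambda> ^ j * cmod (F z)" if "j \<le> k" for j
        using that
      proof (induction j)
        case (Suc j)
        have "cmod ((deriv ^^ Suc j) F z) \<le> \<Lambda> * cmod ((deriv ^^ j) F z)" using step Suc by simp
        also have "\<dots> \<le> \<Lambda> * (\<Lambda> ^ j * cmod (F z))" using Suc \<Lambda>1 by (intro mult_left_mono) auto
        finally show ?case by simp
      qed simp
      \<comment> \<open>\<open>\<phi> = l1 K\<close> and \<open>\<phi> / F = l1 K - l2 K\<close>.\<close>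
      define K l1 l2 where "K = (deriv ^^ k) F z / F z - 1" and "l1 = deriv F z / (F z - 1)" and "l2 = deriv F z / F z"
      have Lk: "1 \<le> \<Lambda> ^ k" using \<Lambda>1 by (simp add: one_le_power)
      have "cmod ((deriv ^^ k) F z / F z) \<le> \<Lambda> ^ k" using pw[of k] Fz by (simp add: norm_divide field_simps)
      hence Kb: "cmod K \<le> 2 * \<Lambda> ^ k" using norm_triangle_ineq4[of "(deriv ^^ k) F z / F z" 1] Lk by (simp add: K_def)
      have dG: "deriv (G k) z = deriv F z" unfolding G_def
        by (rule DERIV_imp_deriv) (auto intro!: derivative_eq_intros DERIV_entire F)
      have l1b: "cmod l1 \<le> \<Lambda>" using rL[of k z] z dG by (simp add: G_def l1_def)
      have l2b: "cmod l2 \<le> \<Lambda>" using rL[of 0 z] z k by (simp add: G_def l2_def)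
      have \<phi>e: "\<phi> z = l1 * K" using eq1[of z] Fz F1z by (simp add: l1_def K_def field_simps)
      have \<phi>F: "\<phi> z / F z = \<phi> z - l2 * K"
      proof -
        have "\<phi> z - \<phi> z / F z = \<phi> z * (F z * (F z - 1)) / (F z * F z)" using Fz by (simp add: field_simps)
        also have "\<dots> = l2 * K" unfolding eq1 using Fz by (simp add: l2_def K_def field_simps)
        finally show ?thesis by (simp add: algebra_simps)
      qed
      have b1: "cmod (l1 * K) \<le> 2 * \<Lambda> ^ (k + 1)" "cmod (l2 * K) \<le> 2 * \<Lambda> ^ (k + 1)"
        using mult_mono[OF l1b Kb] mult_mono[OF l2b Kb] \<Lambda>1 by (simp_all add: norm_mult mult.left_commute)
      have pQ: "cmod (\<phi> z) \<le> Q" using b1 \<Lambda>1 by (simp add: \<phi>e Q_def) (smt (verit) mult_nonneg_nonneg zero_le_power)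
      have fQ: "cmod (\<phi> z / F z) \<le> Q"
        using b1 norm_triangle_ineq4[of "\<phi> z" "l2 * K"] unfolding \<phi>F by (simp add: \<phi>e Q_def)
      have "\<psi> z = \<phi> z ^ (k + 1) * (\<phi> z / F z)" using eq2[of z] Fz by (simp add: field_simps)
      hence "cmod (\<psi> z) = cmod (\<phi> z) ^ (k + 1) * cmod (\<phi> z / F z)" by (simp only: norm_mult norm_power)
      also have "\<dots> \<le> Q ^ (k + 1) * Q" using pQ fQ Q by (intro mult_mono power_mono) auto
      also have "\<dots> = Q ^ (k + 2)" by simp
      finally have "cmod (\<psi> z) \<le> exp S" using Qexp by (simp only:)
      moreover have "cmod (F z * \<psi> z) = cmod (\<phi> z) ^ (k + 2)" using eq2[of z] by (simp only: mult.commute norm_power)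
      hence "cmod (F z * \<psi> z) \<le> exp S" using pQ by (simp only: Qexp[symmetric]) (intro power_mono, auto)
      ultimately show ?thesis by simp
    qed
    define T where "T = S + 1 + \<bar>ln (cmod (\<psi> 0))\<bar>"
    have lnL: "ln \<Lambda> = ln C2 + 2 * ln a + 5 * ln X"
      using C2 a X by (simp add: \<Lambda>_def ln_mult ln_realpow)
    have lna: "ln a \<ge> 0" using a by simp
    have lnQ: "ln Q = ln 4 + (k + 1) * ln \<Lambda>" using \<Lambda>1 by (simp add: Q_def ln_mult ln_realpow del: power_Suc)
    have Teq: "T = C3 + 2 * c * ln a + 5 * c * ln X"
      unfolding T_def S_def lnQ lnL C3_def c_def by (simp add: algebra_simps)
    have T0: "T \<ge> 0" using cC lna lnX by (simp add: Teq)
    have "2 * c * ln a \<le> 5 * c * ln a" using cC lna by (intro mult_right_mono) auto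
    moreover have "C3 * 1 \<le> C3 * (1 + ln a + ln X)" using cC lna lnX by (intro mult_left_mono) auto
    ultimately have Tle: "T \<le> C4 * (1 + ln a + ln X)" using cC lna lnX
      by (simp add: Teq C4_def algebra_simps)
    have Fb: "cmod (F z) \<le> exp (12 * X * T)" if z: "cmod z \<le> \<rho>" for z
    proof -
      have "cmod (F z) \<le> exp (2 * (\<rho> + d) / d * (S + 1 - ln (cmod (\<psi> 0))))"
        by (rule entire_quotient_bound[OF F \<psi> \<psi>0, where r = r]) (use \<rho> d r on_circle z in auto)
      also have "\<dots> \<le> exp (2 * (\<rho> + d) / d * T)"
        unfolding exp_le_cancel_iff T_def by (rule mult_left_mono) (use \<rho> d in auto)
      also have "\<dots> \<le> exp (12 * X * T)"
      proof -
        have "2 * (\<rho> + d) / d \<le> 12 * X" using \<delta> \<rho> by (simp add: d_def X_def R_def field_simps)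
        thus ?thesis unfolding exp_le_cancel_iff using T0 by (rule mult_right_mono)
      qed
      finally show ?thesis .
    qed
    have "M \<rho> \<le> exp (12 * X * T)" by (rule Mle) (use Fb \<rho> in auto)
    moreover have "1 \<le> exp (12 * X * T)" using X T0 by simp
    ultimately have "3 + M \<rho> \<le> 4 * exp (12 * X * T)" by linarith
    hence "A \<rho> \<le> ln (4 * exp (12 * X * T))" unfolding A_def using M0[of \<rho>] \<rho> by (subst ln_le_cancel_iff) auto
    also have "\<dots> = ln 4 + 12 * X * T" by (simp add: ln_mult)
    also have "ln 4 \<le> (2::real)" using ln_le_minus_one[of 2] by (subst ln_realpow[of 2 2, simplified]) auto
    also have "2 + 12 * X * T \<le> 2 * (X * (1 + ln a + ln X)) + 12 * X * (C4 * (1 + ln a + ln X))"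
      using X Tle lna lnX mult_mono[of 1 X 1 "1 + ln a + ln X"] by (intro add_mono mult_left_mono) auto
    also have "\<dots> = (2 + 12 * C4) * X * (1 + ln a + ln X)" by (simp add: algebra_simps)
    finally show ?thesis by (simp add: X_def R_def a_def)
  qed
  obtain B where B: "\<And>\<rho>. 1 \<le> \<rho> \<Longrightarrow> A \<rho> \<le> B"
    using bounded_if_slow_self_growth[of A "2 + 12 * C4", OF Amono A1 main] by blast
  have "cmod (F z) \<le> exp B" for z
  proof -
    let ?\<rho> = "max 1 (cmod z)"
    have "cmod (F z) \<le> M ?\<rho>" by (rule Mge) simp
    also have "\<dots> \<le> exp (A ?\<rho>)" using expA[of ?\<rho>] by simp
    also have "\<dots> \<le> exp B" using B[of ?\<rho>] by simp
    finally show ?thesis .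
  qed
  thus ?thesis by (auto simp: bounded_iff)
qed

section \<open>The theorem in one variable\<close>

lemma higher_deriv_translate:
  assumes "f holomorphic_on UNIV"
  shows "(deriv ^^ j) (\<lambda>z. f (z + b)) = (\<lambda>z. (deriv ^^ j) f (z + b))"
proof
  show "(deriv ^^ j) (\<lambda>z. f (z + b)) z = (deriv ^^ j) f (z + b)" for z
    using higher_deriv_compose_linear'[OF assms open_UNIV open_UNIV UNIV_I, of 1 b j z] by simp
qed

lemma higher_deriv_zero: "(deriv ^^ m) (\<lambda>_. 0 :: complex) = (\<lambda>_. 0)"
  by (induction m) auto

text \<open>If \<open>F\<close> differed from its \<open>k\<close>-th derivative, a translation to a point where the finitely many relevant
functions do not vanish would make \<open>bounded_if_auxiliary\<close> applicable, and \<open>F\<close> would be constant by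
Liouville's theorem.\<close>

lemma power_eq_its_derivative:
  assumes g: "g holomorphic_on UNIV" and k: "0 < k" and kn: "n \<ge> k + 2" and F: "F = (\<lambda>z. g z ^ n)"
    and nz: "\<exists>z. (deriv ^^ k) F z \<noteq> 0" and share: "\<And>z. F z = 1 \<Longrightarrow> (deriv ^^ k) F z = 1"
  shows "(deriv ^^ k) F = F"
proof (rule ccontr)
  assume neq: "(deriv ^^ k) F \<noteq> F"
  have Fh: "F holomorphic_on UNIV" unfolding F by (intro holomorphic_intros g)
  \<comment> \<open>The functions that must not vanish at the new origin.\<close>
  define G where "G i = (if i \<le> k then (deriv ^^ i) F else if i = k + 1 then (\<lambda>z. F z - 1) else (\<lambda>z. (deriv ^^ k) F z - F z))" for i
  have Gh: "G i holomorphic_on UNIV" for i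
    unfolding G_def using Fh entire_higher_deriv by (auto intro!: holomorphic_intros)
  have G1: "\<exists>z. F z \<noteq> 1"
  proof (rule ccontr)
    assume "\<not> ?thesis"
    hence "F = (\<lambda>_. 1)" by auto
    moreover have "(deriv ^^ k) (\<lambda>_. 1) z = 0" for z :: complex using k by (simp add: higher_deriv_const)
    ultimately show False using nz by simp
  qed
  have Gnz: "\<exists>z. G i z \<noteq> 0" for i
  proof (rule ccontr)
    assume "\<not> ?thesis"
    hence 0: "G i z = 0" for z by auto
    consider "i \<le> k" | "i = k + 1" | "i > k + 1" by linarith
    thus False
    proof cases
      case 1
      hence "(deriv ^^ i) F = (\<lambda>_. 0)" using 0 by (auto simp: G_def)
      hence "(deriv ^^ (k - i)) ((deriv ^^ i) F) = (\<lambda>_. 0)" by (simp add: higher_deriv_zero)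
      moreover have "(deriv ^^ (k - i)) ((deriv ^^ i) F) = (deriv ^^ k) F"
        using 1 by (metis comp_apply funpow_add le_add_diff_inverse2)
      ultimately show False using nz by simp
    next
      case 2
      thus False using 0 G1 by (auto simp: G_def)
    next
      case 3
      thus False using 0 neq by (auto simp: G_def)
    qed
  qed
  obtain b where b: "\<forall>i\<in>{..k+2}. G i b \<noteq> 0"
    using common_nonzero_point[of "{..k+2}" G] Gh Gnz by auto
  define h where "h z = g (z + b)" for z
  define H where "H = (\<lambda>z. h z ^ n)"
  have hh: "h holomorphic_on UNIV" unfolding h_def
    by (intro holomorphic_on_compose_gen[OF _ g, unfolded o_def] holomorphic_intros) auto
  have Hh: "H holomorphic_on UNIV" unfolding H_def by (intro holomorphic_intros hh)
  have HF: "H = (\<lambda>z. F (z + b))" by (simp add: H_def h_def F)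
  have dH: "(deriv ^^ j) H z = (deriv ^^ j) F (z + b)" for j z
    unfolding HF higher_deriv_translate[OF Fh] by simp
  have shareH: "(deriv ^^ k) H z = 1" if "H z = 1" for z using that share by (simp add: dH) (simp add: HF)
  have H1: "\<exists>z. H z \<noteq> 1" using G1 unfolding HF by (metis diff_add_cancel)
  obtain \<phi> \<psi> where aux: "\<phi> holomorphic_on UNIV" "\<psi> holomorphic_on UNIV"
    "\<And>z. \<phi> z * (H z * (H z - 1)) = deriv H z * ((deriv ^^ k) H z - H z)"
    "\<And>z. \<psi> z * H z = \<phi> z ^ (k + 2)"
    using auxiliary_entire_functions[OF hh kn H_def shareH H1] by metis
  have "bounded (range H)"
  proof (rule bounded_if_auxiliary[OF Hh aux(1,2) k aux(3,4)])
    show "(deriv ^^ j) H 0 \<noteq> 0" if "j \<le> k" for j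
      using bspec[OF b, of j] that by (simp add: dH G_def)
    show "H 0 \<noteq> 1" using bspec[OF b, of "k + 1"] by (simp add: HF G_def)
    show "(deriv ^^ k) H 0 \<noteq> H 0" using bspec[OF b, of "k + 2"] by (simp add: dH G_def) (simp add: HF)
  qed
  hence "H constant_on UNIV" by (rule Liouville_theorem[OF Hh])
  then obtain c where "H = (\<lambda>_. c)" by (auto simp: constant_on_def)
  hence "(deriv ^^ k) H 0 = 0" using k by (simp add: higher_deriv_const)
  thus False using bspec[OF b, of k] by (simp add: dH G_def)
qed

lemma higher_deriv_periodic:
  assumes "(deriv ^^ k) F = F" "0 < k"
  shows "(deriv ^^ m) F = (deriv ^^ (m mod k)) F"
proof (induction m rule: less_induct)
  case (less m)
  show ?case
  proof (cases "m < k")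
    case False
    hence "(deriv ^^ m) F = (deriv ^^ (m - k)) ((deriv ^^ k) F)"
      by (metis comp_apply funpow_add le_add_diff_inverse2 not_less)
    also have "\<dots> = (deriv ^^ ((m - k) mod k)) F" using less[of "m - k"] False assms by simp
    also have "(m - k) mod k = m mod k" using False by (simp add: le_mod_geq)
    finally show ?thesis .
  qed simp
qed

text \<open>Periodicity of the derivatives bounds all Taylor coefficients at \<open>0\<close> by those of a multiple of \<open>exp\<close>.\<close>

lemma exponential_bound:
  fixes F :: "complex \<Rightarrow> complex"
  assumes F: "F holomorphic_on UNIV" and per: "(deriv ^^ k) F = F" and k: "0 < k"
  obtains M where "M > 0" "\<And>z. cmod (F z) \<le> M * exp (cmod z)"
proof -
  define M where "M = (\<Sum>i<k. cmod ((deriv ^^ i) F 0)) + 1"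
  have M: "M > 0" unfolding M_def by (intro add_nonneg_pos sum_nonneg) auto
  have dM: "cmod ((deriv ^^ m) F 0) \<le> M" for m
  proof -
    have "cmod ((deriv ^^ (m mod k)) F 0) \<le> (\<Sum>i<k. cmod ((deriv ^^ i) F 0))"
      by (rule member_le_sum[of _ _ "\<lambda>i. cmod ((deriv ^^ i) F 0)"]) (use k in auto)
    thus ?thesis unfolding higher_deriv_periodic[OF per k, of m] M_def by linarith
  qed
  show thesis
  proof (rule that[OF M])
    fix z
    have "(\<lambda>n. (deriv ^^ n) F 0 / fact n * (z - 0) ^ n) sums F z"
      by (rule holomorphic_power_series[of _ _ "cmod z + 1"]) (use F in \<open>auto intro: holomorphic_on_subset\<close>)
    hence "F z = (\<Sum>n. (deriv ^^ n) F 0 / fact n * z ^ n)" by (simp add: sums_iff)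
    moreover have "(\<lambda>n. M * (cmod z ^ n /\<^sub>R fact n)) sums (M * exp (cmod z))"
      by (intro sums_mult exp_converges)
    moreover have "cmod ((deriv ^^ n) F 0 / fact n * z ^ n) \<le> M * (cmod z ^ n /\<^sub>R fact n)" for n
    proof -
      have "cmod ((deriv ^^ n) F 0) * (cmod z ^ n / fact n) \<le> M * (cmod z ^ n / fact n)"
        by (rule mult_right_mono[OF dM]) simp
      moreover have "cmod ((deriv ^^ n) F 0 / fact n * z ^ n) = cmod ((deriv ^^ n) F 0) * (cmod z ^ n / fact n)"
        by (simp add: norm_mult norm_divide norm_power)
      ultimately show ?thesis by (simp add: divide_inverse mult_ac)
    qed
    ultimately show "cmod (F z) \<le> M * exp (cmod z)"
      using norm_suminf_le[of "\<lambda>n. (deriv ^^ n) F 0 / fact n * z ^ n" "\<lambda>n. M * (cmod z ^ n /\<^sub>R fact n)"]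
      by (simp add: sums_iff)
  qed
qed

text \<open>The bound for \<open>F' / F\<close> at \<open>z\<close> on the disc of radius \<open>R\<close> is of order \<open>R (K + R) / (R - \<bar>z\<bar>)\<^sup>2\<close>, which stays
bounded when \<open>R\<close> is comparable to \<open>2 \<bar>z\<bar>\<close>; Liouville's theorem does the rest.\<close>

lemma log_derivative_constant:
  fixes F :: "complex \<Rightarrow> complex"
  assumes F: "F holomorphic_on UNIV" and nz: "\<And>z. F z \<noteq> 0" and M: "M > 0"
    and bd: "\<And>z. cmod (F z) \<le> M * exp (cmod z)"
  obtains l where "\<And>z. deriv F z = l * F z"
proof -
  define K where "K = ln M + 1 - ln (cmod (F 0))"
  have "cmod (deriv F z / F z) \<le> 32 * (\<bar>K\<bar> + 1)" for z
  proof -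
    define R where "R = 2 * cmod z + 1"
    have R: "R \<ge> 1" and half: "R / 2 \<le> R - cmod z" by (simp_all add: R_def)
    have "cmod (deriv F z / F z) \<le> 8 * R / (R - cmod z)\<^sup>2 * ((ln M + 1 + R) - ln (cmod (F 0)))"
    proof (rule zero_free_bounds(2))
      fix w :: complex assume w: "w \<in> ball 0 R"
      have "cmod (F w) \<le> M * exp (cmod w)" by (rule bd)
      also have "\<dots> < M * exp (1 + R)" using w M by (intro mult_strict_left_mono) auto
      also have "\<dots> = exp (ln M + 1 + R)" using M by (simp add: exp_add)
      finally show "cmod (F w) < exp (ln M + 1 + R)" .
    qed (use F nz in \<open>auto simp: R_def intro: holomorphic_on_subset add_nonneg_pos\<close>)
    also have "(ln M + 1 + R) - ln (cmod (F 0)) = K + R" by (simp add: K_def)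
    also have "8 * R / (R - cmod z)\<^sup>2 * (K + R) \<le> 8 * R / (R / 2)\<^sup>2 * ((\<bar>K\<bar> + 1) * R)"
    proof (intro mult_mono frac_le power_mono)
      have "\<bar>K\<bar> * 1 \<le> \<bar>K\<bar> * R" using R by (intro mult_left_mono) auto
      moreover have "K \<le> \<bar>K\<bar>" by simp
      ultimately show "K + R \<le> (\<bar>K\<bar> + 1) * R" unfolding distrib_right mult_1 by linarith
      have "cmod (F 0) \<le> M" using bd[of 0] by simp
      hence "ln (cmod (F 0)) \<le> ln M" using nz M by (subst ln_le_cancel_iff) auto
      thus "0 \<le> K + R" using R by (simp add: K_def)
    qed (use R half in auto)
    also have "\<dots> = 32 * (\<bar>K\<bar> + 1)" using R by (simp add: power2_eq_square field_simps)
    finally show ?thesis .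
  qed
  hence "bounded (range (\<lambda>z. deriv F z / F z))" unfolding bounded_iff by blast
  moreover have "(\<lambda>z. deriv F z / F z) holomorphic_on UNIV" using F nz by (intro holomorphic_intros) auto
  ultimately have "(\<lambda>z. deriv F z / F z) constant_on UNIV" using Liouville_theorem by blast
  then obtain l where "\<And>z. deriv F z / F z = l" by (auto simp: constant_on_def)
  hence "deriv F z = l * F z" for z by (metis nz nonzero_eq_divide_eq)
  thus thesis by (rule that)
qed

text \<open>Once \<open>F = g\<^sup>n\<close> is known to equal its \<open>k\<close>-th derivative, it has no zeros: \<open>g\<close> divides every derivative of
order below \<open>n\<close>, so by periodicity a zero of \<open>g\<close> would be a zero of all derivatives.  Hence \<open>F' / F\<close> is a
constant \<open>l\<close>, and \<open>F' = l F\<close> is a multiple of the equation claimed for \<open>g\<close>.\<close>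

theorem power_sharing_one_variable:
  fixes g :: "complex \<Rightarrow> complex"
  assumes g: "g holomorphic_on UNIV" and k: "0 < k" and kn: "n \<ge> k + 2"
    and nz: "\<exists>z. (deriv ^^ k) (\<lambda>z. g z ^ n) z \<noteq> 0"
    and share: "\<And>z. g z ^ n = 1 \<Longrightarrow> (deriv ^^ k) (\<lambda>z. g z ^ n) z = 1"
  shows "\<exists>c. c \<noteq> 0 \<and> (c / of_nat n) ^ k = 1 \<and> (\<forall>z. g z = c * deriv g z)"
proof -
  define F where "F = (\<lambda>z. g z ^ n)"
  have Fh: "F holomorphic_on UNIV" unfolding F_def by (intro holomorphic_intros g)
  have per: "(deriv ^^ k) F = F"
    by (rule power_eq_its_derivative[OF g k kn F_def]) (use nz share in \<open>auto simp: F_def\<close>)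
  have n0: "n > 0" using kn by simp
  have gnz: "g a \<noteq> 0" for a
  proof
    assume ga: "g a = 0"
    have *: "(deriv ^^ j) F a = 0" if "j < k" for j
      using higher_deriv_power_divisible[OF g, of j n] ga that kn by (auto simp: F_def power_0_left)
    have "(deriv ^^ m) F a = 0" for m
      unfolding higher_deriv_periodic[OF per k, of m] using * k by simp
    hence "F z = 0" for z
      using holomorphic_fun_eq_0_on_connected[OF Fh open_UNIV connected_UNIV] by blast
    hence "F = (\<lambda>_. 0)" by auto
    thus False using nz per by (auto simp: F_def)
  qed
  hence Fnz: "F z \<noteq> 0" for z by (simp add: F_def)
  obtain M where M: "M > 0" "\<And>z. cmod (F z) \<le> M * exp (cmod z)" using exponential_bound[OF Fh per k] by blast
  obtain l where l: "\<And>z. deriv F z = l * F z" using log_derivative_constant[OF Fh Fnz M] by blast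
  have "(deriv ^^ j) F = (\<lambda>z. l ^ j * F z)" for j
  proof (induction j)
    case (Suc j)
    have "((\<lambda>z. l ^ j * F z) has_field_derivative l ^ j * (l * F z)) (at z)" for z
      using DERIV_cmult[OF DERIV_entire[OF Fh, of z], of "l ^ j"] by (simp add: l)
    hence "deriv (\<lambda>z. l ^ j * F z) = (\<lambda>z. l ^ Suc j * F z)"
      by (auto simp: fun_eq_iff mult_ac dest: DERIV_imp_deriv)
    thus ?case using Suc by simp
  qed simp
  hence "F 0 = l ^ k * F 0" using per by metis
  hence lk: "l ^ k = 1" using Fnz[of 0] by simp
  hence l0: "l \<noteq> 0" using k by (auto simp: power_0_left)
  have "deriv F z = of_nat n * g z ^ (n - 1) * deriv g z" for z
    unfolding F_def by (rule DERIV_imp_deriv) (auto intro!: derivative_eq_intros DERIV_entire g)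
  hence "of_nat n * g z ^ (n - 1) * deriv g z = l * (g z ^ (n - 1) * g z)" for z
    using l[of z] n0 by (simp add: F_def flip: power_Suc2)
  hence "g z ^ (n - 1) * (of_nat n * deriv g z) = g z ^ (n - 1) * (l * g z)" for z
    by (metis mult.assoc mult.left_commute)
  hence "of_nat n * deriv g z = l * g z" for z using gnz[of z] by (metis mult_left_cancel power_not_zero)
  hence "g z = of_nat n / l * deriv g z" for z using l0 by (simp add: field_simps)
  moreover have "(of_nat n / l / of_nat n) ^ k = 1" using n0 lk l0 by (simp add: power_divide)
  ultimately show ?thesis using n0 l0 by (intro exI[of _ "of_nat n / l"]) auto
qed

section \<open>Entire functions of several variables\<close>

lemma smult_axis: "t *s axis j (1::complex) = axis j t"
  by (simp add: vec_eq_iff axis_def)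

lemma bounded_linear_smult_vec: "bounded_linear (\<lambda>t::complex. t *s (u :: complex ^ 'm))"
  unfolding linear_conv_bounded_linear[symmetric]
  by (rule linearI) (auto simp: vec_eq_iff algebra_simps)

lemma has_field_derivative_along_line:
  assumes "(f has_derivative (\<lambda>h. \<Sum>j\<in>UNIV. A $ j * h $ j)) (at (z + s *s (u :: complex ^ 'm)))"
  shows "((\<lambda>t. f (z + t *s u)) has_field_derivative (\<Sum>j\<in>UNIV. A $ j * u $ j)) (at s)"
proof -
  have "((\<lambda>t. z + t *s u) has_derivative (\<lambda>t. t *s u)) (at s)"
    by (auto intro!: derivative_eq_intros bounded_linear.has_derivative[OF bounded_linear_smult_vec])
  from has_derivative_compose[OF this assms]
  have "((\<lambda>t. f (z + t *s u)) has_derivative (\<lambda>t. \<Sum>j\<in>UNIV. A $ j * (t *s u) $ j)) (at s)" .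
  moreover have "(\<lambda>t. \<Sum>j\<in>UNIV. A $ j * (t *s u) $ j) = (*) (\<Sum>j\<in>UNIV. A $ j * u $ j)"
    by (auto simp: fun_eq_iff sum_distrib_left mult_ac)
  ultimately show ?thesis by (simp add: has_field_derivative_def)
qed

lemma entire_has_derivative:
  assumes "entire f"
  shows "(f has_derivative (\<lambda>h. \<Sum>j\<in>UNIV. partial_deriv j f a * h $ j)) (at a)"
proof -
  obtain A where A: "(f has_derivative (\<lambda>h. \<Sum>j\<in>UNIV. A $ j * h $ j)) (at a)"
    using assms by (auto simp: entire_def)
  have "partial_deriv j f a = A $ j" for j
  proof -
    have "((\<lambda>t. f (a + t *s axis j 1)) has_field_derivative (\<Sum>i\<in>UNIV. A $ i * axis j 1 $ i)) (at 0)"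
      by (rule has_field_derivative_along_line) (use A in simp)
    also have "(\<Sum>i\<in>UNIV. A $ i * axis j 1 $ i) = A $ j"
      by (simp add: axis_def if_distrib[of "\<lambda>x. _ * x"] cong: if_cong)
    finally show ?thesis unfolding partial_deriv_def smult_axis by (rule DERIV_imp_deriv)
  qed
  thus ?thesis using A by simp
qed

text \<open>The link to one variable: along a line in direction \<open>u\<close>, differentiation is \<open>dir_deriv u\<close>.\<close>

lemma entire_line_DERIV:
  assumes "entire f"
  shows "((\<lambda>t. f (z + t *s u)) has_field_derivative dir_deriv u f (z + s *s u)) (at s)"
proof -
  have "((\<lambda>t. f (z + t *s u)) has_field_derivative
      (\<Sum>j\<in>UNIV. (\<chi> j. partial_deriv j f (z + s *s u)) $ j * u $ j)) (at s)"
    by (rule has_field_derivative_along_line) (use entire_has_derivative[OF assms] in simp)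
  thus ?thesis by (simp add: dir_deriv_def mult.commute)
qed

lemma entire_line_holomorphic: "entire f \<Longrightarrow> (\<lambda>t. f (z + t *s u)) holomorphic_on UNIV"
  unfolding holomorphic_on_open[OF open_UNIV] by (intro ballI exI) (rule entire_line_DERIV)

lemma entire_continuous: "entire f \<Longrightarrow> continuous_on S f"
  by (intro continuous_at_imp_continuous_on ballI) (rule has_derivative_continuous[OF entire_has_derivative])

text \<open>Continuity of the partial derivatives is what the Leibniz rule asks for; the derivative of the
integral is complex linear because its integrand is.\<close>

lemma entire_parameter_integral:
  fixes f :: "complex ^ 'm \<Rightarrow> complex" and p :: "real \<Rightarrow> complex ^ 'm"
  assumes f: "entire f" and c: "\<And>j. continuous_on UNIV (partial_deriv j f)"
    and p: "continuous_on (cbox 0 1) p" and q: "continuous_on (cbox 0 1) q"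
  shows "entire (\<lambda>z. integral (cbox 0 1) (\<lambda>x. f (z + p x) * q x))"
  unfolding entire_def
proof
  fix a
  let ?d = "\<lambda>z x h. (\<Sum>j\<in>UNIV. partial_deriv j f (z + p x) * h $ j) * q x"
  have hd: "((\<lambda>z. f (z + p x) * q x) has_derivative ?d z x) (at z within UNIV)" for z x
  proof -
    have "((\<lambda>z. z + p x) has_derivative (\<lambda>h. h)) (at z)" by (auto intro!: derivative_eq_intros)
    from has_derivative_compose[OF this entire_has_derivative[OF f]]
    have "((\<lambda>z. f (z + p x)) has_derivative (\<lambda>h. \<Sum>j\<in>UNIV. partial_deriv j f (z + p x) * h $ j)) (at z)" .
    thus ?thesis by (auto intro: has_derivative_mult_left)
  qed
  define D where "D z x = Blinfun (?d z x)" for z x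
  have D: "blinfun_apply (D z x) = ?d z x" for z x
    unfolding D_def by (rule bounded_linear_Blinfun_apply[OF has_derivative_bounded_linear[OF hd]])
  have c': "continuous_on (UNIV \<times> cbox 0 1) (\<lambda>y. partial_deriv j f (fst y + p (snd y)))" for j
    by (rule continuous_on_compose2[OF c]) (auto intro!: continuous_intros continuous_on_compose2[OF p])
  have fc: "continuous_on (UNIV \<times> cbox 0 1) (\<lambda>y. f (fst y + p (snd y)))"
    by (rule continuous_on_compose2[OF entire_continuous[OF f, of UNIV]]) (auto intro!: continuous_intros continuous_on_compose2[OF p])
  have q': "continuous_on (UNIV \<times> cbox 0 1) (\<lambda>y. q (snd y))"
    by (rule continuous_on_compose2[OF q]) (auto intro!: continuous_intros)
  have int: "(\<lambda>x. f (z + p x) * q x) integrable_on cbox 0 1" for z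
    by (intro integrable_continuous continuous_intros q continuous_on_compose2[OF entire_continuous[OF f, of UNIV]] p) auto
  have cD: "continuous_on (UNIV \<times> cbox 0 1) (\<lambda>(z, x). D z x)"
    by (rule continuous_on_blinfun_componentwise) (auto simp: case_prod_beta D simp del: box_real intro!: continuous_intros c' q')
  have Dint: "D a integrable_on cbox 0 1"
  proof (rule integrable_continuous, rule continuous_on_compose2[OF cD, of _ "\<lambda>x. (a, x)", simplified])
    show "continuous_on (cbox 0 1) (Pair a)" by (auto intro!: continuous_intros)
  qed auto
  have "((\<lambda>z. integral (cbox 0 1) (\<lambda>x. f (z + p x) * q x)) has_derivative integral (cbox 0 1) (D a)) (at a within UNIV)"
    by (rule leibniz_rule[where U = UNIV]) (use hd int cD D in auto)
  moreover have "integral (cbox 0 1) (D a) h = (\<Sum>j\<in>UNIV. (\<chi> j. integral (cbox 0 1) (\<lambda>x. partial_deriv j f (a + p x) * q x)) $ j * h $ j)" for h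
  proof -
    have int': "(\<lambda>x. partial_deriv j f (a + p x) * q x) integrable_on cbox 0 1" for j
      by (intro integrable_continuous continuous_intros q continuous_on_compose2[OF c] p) auto
    have "integral (cbox 0 1) (D a) h = integral (cbox 0 1) (\<lambda>x. D a x h)"
      by (rule blinfun_apply_integral[OF Dint])
    also have "\<dots> = integral (cbox 0 1) (\<lambda>x. \<Sum>j\<in>UNIV. (partial_deriv j f (a + p x) * q x) * h $ j)"
      by (simp add: D sum_distrib_right sum_distrib_left mult_ac)
    also have "\<dots> = (\<Sum>j\<in>UNIV. integral (cbox 0 1) (\<lambda>x. (partial_deriv j f (a + p x) * q x) * h $ j))"
      by (rule integral_sum) (rule finite, rule integrable_on_mult_left, rule int')
    finally show ?thesis by (simp only: integral_mult_left vec_lambda_beta)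
  qed
  hence "blinfun_apply (integral (cbox 0 1) (D a)) =
      (\<lambda>h. \<Sum>j\<in>UNIV. (\<chi> j. integral (cbox 0 1) (\<lambda>x. partial_deriv j f (a + p x) * q x)) $ j * h $ j)"
    by (rule ext)
  ultimately show "\<exists>A. ((\<lambda>z. integral (cbox 0 1) (\<lambda>x. f (z + p x) * q x)) has_derivative (\<lambda>h. \<Sum>j\<in>UNIV. A $ j * h $ j)) (at a)"
    by (intro exI) (simp only:)
qed

lemma partial_deriv_Cauchy:
  assumes f: "entire f"
  shows "partial_deriv j f z = integral (cbox 0 1)
    (\<lambda>x. f (z + axis j (exp (2 * of_real pi * \<i> * of_real x))) * inverse (exp (2 * of_real pi * \<i> * of_real x)))"
proof -
  define \<phi> where "\<phi> t = f (z + axis j t)" for t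
  have \<phi>: "\<phi> holomorphic_on UNIV" unfolding \<phi>_def
    using entire_line_holomorphic[OF f, of z "axis j 1"] unfolding smult_axis .
  let ?e = "\<lambda>x. exp (2 * of_real pi * \<i> * of_real x) :: complex"
  have "(\<phi> has_field_derivative (1 / (2 * of_real pi * \<i>) * contour_integral (circlepath 0 1) (\<lambda>u. \<phi> u / (u - 0)^2))) (at 0)"
    by (rule Cauchy_derivative_integral_circlepath(2))
       (use \<phi> in \<open>auto intro: holomorphic_on_subset holomorphic_on_imp_continuous_on\<close>)
  hence "partial_deriv j f z = 1 / (2 * of_real pi * \<i>) * contour_integral (circlepath 0 1) (\<lambda>u. \<phi> u / (u - 0)^2)"
    unfolding partial_deriv_def \<phi>_def[symmetric] by (simp add: DERIV_imp_deriv)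
  also have "contour_integral (circlepath 0 1) (\<lambda>u. \<phi> u / (u - 0)^2) =
      integral {0..1} (\<lambda>x. (2 * of_real pi * \<i>) * (\<phi> (?e x) * inverse (?e x)))"
    unfolding contour_integral_integral vector_derivative_circlepath
    by (intro integral_cong) (simp add: circlepath power2_eq_square field_simps)
  also have "1 / (2 * of_real pi * \<i>) * \<dots> = integral {0..1} (\<lambda>x. \<phi> (?e x) * inverse (?e x))"
    unfolding integral_mult_right by simp
  finally show ?thesis by (simp add: \<phi>_def)
qed

text \<open>Cauchy's formula represents a partial derivative as an integral of translates of \<open>f\<close> itself.
This shows first that the partial derivatives are continuous, and then, by differentiation under
the integral, that they are entire.\<close>

lemma entire_partial_deriv:
  assumes f: "entire f"
  shows "entire (partial_deriv j f)"
proof -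
  let ?p = "\<lambda>j x. axis j (exp (2 * of_real pi * \<i> * of_real x)) :: complex ^ 'm"
    and ?q = "\<lambda>x. inverse (exp (2 * of_real pi * \<i> * of_real x)) :: complex"
  have eq: "partial_deriv j f = (\<lambda>z. integral (cbox 0 1) (\<lambda>x. f (z + ?p j x) * ?q x))" for j
    using partial_deriv_Cauchy[OF f] by (rule ext)
  have p: "continuous_on S (?p j)" for j S
  proof -
    have "continuous_on S (\<lambda>x. exp (2 * of_real pi * \<i> * of_real x) :: complex)" by (intro continuous_intros)
    from bounded_linear.continuous_on[OF bounded_linear_smult_vec this, of "axis j 1"]
    show ?thesis unfolding smult_axis .
  qed
  have q: "continuous_on S ?q" for S by (intro continuous_intros) auto
  have c: "continuous_on UNIV (partial_deriv j f)" for j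
    unfolding eq
  proof (rule integral_continuous_on_param)
    have "continuous_on (UNIV \<times> cbox 0 1) (\<lambda>y. ?p j (snd y))"
      by (rule continuous_on_compose2[OF p[of UNIV]]) (auto intro!: continuous_intros)
    moreover have "continuous_on (UNIV \<times> cbox 0 1) (\<lambda>y. ?q (snd y))"
      by (rule continuous_on_compose2[OF q[of UNIV]]) (auto intro!: continuous_intros)
    ultimately
    show "continuous_on (UNIV \<times> cbox 0 1) (\<lambda>(z, x). f (z + ?p j x) * ?q x)"
      unfolding case_prod_beta
      by (intro continuous_intros continuous_on_compose2[OF entire_continuous[OF f, of UNIV]]
          ) auto
  qed
  show ?thesis by (subst eq) (rule entire_parameter_integral[OF f c p q])
qed

lemma entire_linear_combination:
  fixes f :: "'i \<Rightarrow> complex ^ 'b \<Rightarrow> complex"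
  assumes "finite I" "\<And>i. i \<in> I \<Longrightarrow> entire (f i)"
  shows "entire (\<lambda>z. \<Sum>i\<in>I. c i * f i z)"
  unfolding entire_def
proof
  fix a
  have "((\<lambda>z. \<Sum>i\<in>I. c i * f i z) has_derivative (\<lambda>h. \<Sum>i\<in>I. c i * (\<Sum>j\<in>UNIV. partial_deriv j (f i) a * h $ j))) (at a)"
    using assms by (intro has_derivative_sum has_derivative_mult_right entire_has_derivative) auto
  also have "(\<lambda>h. \<Sum>i\<in>I. c i * (\<Sum>j\<in>UNIV. partial_deriv j (f i) a * h $ j))
      = (\<lambda>h. \<Sum>j\<in>UNIV. (\<chi> j. \<Sum>i\<in>I. c i * partial_deriv j (f i) a) $ j * h $ j)"
  proof
    fix h :: "complex ^ 'b"
    have "(\<Sum>i\<in>I. c i * (\<Sum>j\<in>UNIV. partial_deriv j (f i) a * h $ j))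
        = (\<Sum>i\<in>I. \<Sum>j\<in>UNIV. c i * partial_deriv j (f i) a * h $ j)"
      by (simp add: sum_distrib_left mult.assoc)
    also have "\<dots> = (\<Sum>j\<in>UNIV. \<Sum>i\<in>I. c i * partial_deriv j (f i) a * h $ j)" by (rule sum.swap)
    finally show "(\<Sum>i\<in>I. c i * (\<Sum>j\<in>UNIV. partial_deriv j (f i) a * h $ j))
      = (\<Sum>j\<in>UNIV. (\<chi> j. \<Sum>i\<in>I. c i * partial_deriv j (f i) a) $ j * h $ j)"
      by (simp add: sum_distrib_right)
  qed
  finally show "\<exists>A. ((\<lambda>z. \<Sum>i\<in>I. c i * f i z) has_derivative (\<lambda>h. \<Sum>j\<in>UNIV. A $ j * h $ j)) (at a)" by blast
qed

lemma entire_const: "entire (\<lambda>_. c)"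
  unfolding entire_def by (intro allI exI[of _ 0]) simp

lemma entire_diff:
  assumes "entire f" "entire g"
  shows "entire (\<lambda>z. f z - g z)"
proof -
  have "entire (\<lambda>z. \<Sum>i\<in>UNIV. (if i then 1 else -1) * (if i then f else g) z)"
    by (rule entire_linear_combination) (use assms in auto)
  thus ?thesis by (simp add: UNIV_bool)
qed

lemma entire_cmult: "entire f \<Longrightarrow> entire (\<lambda>z. c * f z)"
  using entire_linear_combination[of "{()}" "\<lambda>_. f" "\<lambda>_. c"] by simp

lemma entire_mult:
  assumes "entire f" "entire g"
  shows "entire (\<lambda>z. f z * g z)"
  unfolding entire_def
proof
  fix a
  have "((\<lambda>z. f z * g z) has_derivative (\<lambda>h. f a * (\<Sum>j\<in>UNIV. partial_deriv j g a * h $ j) +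
      (\<Sum>j\<in>UNIV. partial_deriv j f a * h $ j) * g a)) (at a)"
    by (intro has_derivative_mult entire_has_derivative assms)
  also have "(\<lambda>h. f a * (\<Sum>j\<in>UNIV. partial_deriv j g a * h $ j) + (\<Sum>j\<in>UNIV. partial_deriv j f a * h $ j) * g a)
      = (\<lambda>h. \<Sum>j\<in>UNIV. (\<chi> j. f a * partial_deriv j g a + partial_deriv j f a * g a) $ j * h $ j)"
    by (simp add: fun_eq_iff sum_distrib_left sum_distrib_right algebra_simps sum.distrib)
  finally show "\<exists>A. ((\<lambda>z. f z * g z) has_derivative (\<lambda>h. \<Sum>j\<in>UNIV. A $ j * h $ j)) (at a)" by blast
qed

lemma entire_power: "entire f \<Longrightarrow> entire (\<lambda>z. f z ^ n)"
  by (induction n) (auto intro: entire_mult entire_const)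

lemma entire_dir_deriv: "entire f \<Longrightarrow> entire (dir_deriv u f)"
  unfolding dir_deriv_def[abs_def] by (intro entire_linear_combination entire_partial_deriv) auto

lemma entire_dir_deriv_iter: "entire f \<Longrightarrow> entire ((dir_deriv u ^^ k) f)"
  by (induction k) (auto intro: entire_dir_deriv)

lemma dir_deriv_iter_line:
  assumes "entire f"
  shows "(deriv ^^ k) (\<lambda>t. f (z + t *s u)) = (\<lambda>t. (dir_deriv u ^^ k) f (z + t *s u))"
proof (induction k)
  case (Suc k)
  have "deriv (\<lambda>t. (dir_deriv u ^^ k) f (z + t *s u)) s = dir_deriv u ((dir_deriv u ^^ k) f) (z + s *s u)" for s
    by (rule DERIV_imp_deriv[OF entire_line_DERIV[OF entire_dir_deriv_iter[OF assms]]])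
  hence "deriv (\<lambda>t. (dir_deriv u ^^ k) f (z + t *s u)) = (\<lambda>t. (dir_deriv u ^^ Suc k) f (z + t *s u))"
    by auto
  thus ?case using Suc by simp
qed simp

lemma dir_deriv_linear_combination:
  assumes "finite I" "\<And>i. i \<in> I \<Longrightarrow> entire (f i)"
  shows "dir_deriv h (\<lambda>z. \<Sum>i\<in>I. c i * f i z) = (\<lambda>z. \<Sum>i\<in>I. c i * dir_deriv h (f i) z)"
proof
  fix z
  have "((\<lambda>t. \<Sum>i\<in>I. c i * f i (z + t *s h)) has_field_derivative
      dir_deriv h (\<lambda>z. \<Sum>i\<in>I. c i * f i z) (z + 0 *s h)) (at 0)"
    by (rule entire_line_DERIV[OF entire_linear_combination[OF assms]])
  moreover have "((\<lambda>t. \<Sum>i\<in>I. c i * f i (z + t *s h)) has_field_derivative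
      (\<Sum>i\<in>I. c i * dir_deriv h (f i) (z + 0 *s h))) (at 0)"
    by (intro DERIV_sum DERIV_cmult entire_line_DERIV assms)
  ultimately show "dir_deriv h (\<lambda>z. \<Sum>i\<in>I. c i * f i z) z = (\<Sum>i\<in>I. c i * dir_deriv h (f i) z)"
    using DERIV_unique by fastforce
qed

lemma dir_deriv_iter_linear_combination:
  assumes "finite I" "\<And>i. i \<in> I \<Longrightarrow> entire (f i)"
  shows "(dir_deriv h ^^ k) (\<lambda>z. \<Sum>i\<in>I. c i * f i z) = (\<lambda>z. \<Sum>i\<in>I. c i * (dir_deriv h ^^ k) (f i) z)"
proof (induction k)
  case (Suc k)
  have "dir_deriv h (\<lambda>z. \<Sum>i\<in>I. c i * (dir_deriv h ^^ k) (f i) z) = (\<lambda>z. \<Sum>i\<in>I. c i * dir_deriv h ((dir_deriv h ^^ k) (f i)) z)"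
    by (rule dir_deriv_linear_combination) (use assms entire_dir_deriv_iter in auto)
  thus ?case using Suc by simp
qed simp

section \<open>Homogeneous expansions and shared values\<close>

lemma finite_multi_indices: "finite {\<nu> :: 'm::finite \<Rightarrow> nat. (\<Sum>j\<in>UNIV. \<nu> j) = i}"
proof (rule finite_subset)
  show "{\<nu> :: 'm \<Rightarrow> nat. (\<Sum>j\<in>UNIV. \<nu> j) = i} \<subseteq> PiE UNIV (\<lambda>_. {..i})"
    by (auto simp: PiE_def intro: member_le_sum)
  show "finite (PiE UNIV (\<lambda>_. {..i}) :: ('m \<Rightarrow> nat) set)" by (intro finite_PiE) auto
qed

lemma homogeneous_poly_const: "homogeneous_poly 0 (\<lambda>_. c)"
proof -
  have "{\<nu> :: 'a::finite \<Rightarrow> nat. (\<Sum>j\<in>UNIV. \<nu> j) = 0} = {\<lambda>_. 0}" by auto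
  thus ?thesis unfolding homogeneous_poly_def by (intro exI[of _ "\<lambda>_. c"]) simp
qed

lemma homogeneous_poly_sum:
  assumes "finite I" "\<And>i. i \<in> I \<Longrightarrow> homogeneous_poly d (P i)"
  shows "homogeneous_poly d (\<lambda>z. \<Sum>i\<in>I. P i z)"
proof -
  let ?R = "\<lambda>i b. \<forall>z. P i z = (\<Sum>\<nu> | (\<Sum>j\<in>UNIV. \<nu> j) = d. b \<nu> * (\<Prod>j\<in>UNIV. (z $ j) ^ \<nu> j))"
  have "\<forall>i\<in>I. \<exists>b. ?R i b" using assms(2) unfolding homogeneous_poly_def by blast
  from bchoice[OF this] obtain b where b: "\<forall>i\<in>I. ?R i (b i)" by (rule exE)
  have "(\<Sum>i\<in>I. P i z) = (\<Sum>\<nu> | (\<Sum>j\<in>UNIV. \<nu> j) = d. (\<Sum>i\<in>I. b i \<nu>) * (\<Prod>j\<in>UNIV. (z $ j) ^ \<nu> j))" for z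
  proof -
    have "(\<Sum>i\<in>I. P i z) = (\<Sum>i\<in>I. \<Sum>\<nu> | (\<Sum>j\<in>UNIV. \<nu> j) = d. b i \<nu> * (\<Prod>j\<in>UNIV. (z $ j) ^ \<nu> j))"
      using b by simp
    also have "\<dots> = (\<Sum>\<nu> | (\<Sum>j\<in>UNIV. \<nu> j) = d. \<Sum>i\<in>I. b i \<nu> * (\<Prod>j\<in>UNIV. (z $ j) ^ \<nu> j))" by (rule sum.swap)
    finally show ?thesis by (simp add: sum_distrib_right)
  qed
  thus ?thesis unfolding homogeneous_poly_def by (intro exI[of _ "\<lambda>\<nu>. \<Sum>i\<in>I. b i \<nu>"] allI)
qed

lemma homogeneous_poly_cmult:
  assumes "homogeneous_poly d P"
  shows "homogeneous_poly d (\<lambda>z. c * P z)"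
proof -
  obtain b where b: "\<And>z. P z = (\<Sum>\<nu> | (\<Sum>j\<in>UNIV. \<nu> j) = d. b \<nu> * (\<Prod>j\<in>UNIV. (z $ j) ^ \<nu> j))"
    using assms unfolding homogeneous_poly_def by blast
  show ?thesis unfolding homogeneous_poly_def
    by (intro exI[of _ "\<lambda>\<nu>. c * b \<nu>"]) (simp add: b sum_distrib_left mult.assoc)
qed

text \<open>Multiplication by \<open>z\<^sub>j\<close> raises the \<open>j\<close>-th exponent by one; \<open>up\<close> and \<open>dn\<close> below are the corresponding
bijections of multi-indices.\<close>

lemma homogeneous_poly_mult_coord:
  fixes P :: "complex ^ 'm \<Rightarrow> complex"
  assumes "homogeneous_poly d P"
  shows "homogeneous_poly (Suc d) (\<lambda>z. z $ j * P z)"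
proof -
  obtain b where b: "\<And>z. P z = (\<Sum>\<nu> | (\<Sum>j\<in>UNIV. \<nu> j) = d. b \<nu> * (\<Prod>j\<in>UNIV. (z $ j) ^ \<nu> j))"
    using assms unfolding homogeneous_poly_def by blast
  define up where "up \<nu> = \<nu>(j := Suc (\<nu> j))" for \<nu> :: "'m \<Rightarrow> nat"
  define dn where "dn \<nu> = \<nu>(j := \<nu> j - 1)" for \<nu> :: "'m \<Rightarrow> nat"
  define b' where "b' \<nu> = (if \<nu> j = 0 then 0 else b (dn \<nu>))" for \<nu>
  have split: "(\<Sum>i\<in>UNIV. \<nu> i) = \<nu> j + (\<Sum>i\<in>UNIV - {j}. \<nu> i)" for \<nu> :: "'m \<Rightarrow> nat"
    by (rule sum.remove) auto
  have splitp: "(\<Prod>i\<in>UNIV. (z $ i) ^ \<nu> i) = (z $ j) ^ \<nu> j * (\<Prod>i\<in>UNIV - {j}. (z $ i) ^ \<nu> i)"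
    for \<nu> :: "'m \<Rightarrow> nat" and z :: "complex ^ 'm"
    by (rule prod.remove) auto
  have up_sum: "(\<Sum>i\<in>UNIV. up \<nu> i) = Suc (\<Sum>i\<in>UNIV. \<nu> i)" for \<nu> :: "'m \<Rightarrow> nat"
    unfolding split by (simp add: up_def)
  have up_prod: "(\<Prod>i\<in>UNIV. (z $ i) ^ up \<nu> i) = z $ j * (\<Prod>i\<in>UNIV. (z $ i) ^ \<nu> i)"
    for \<nu> :: "'m \<Rightarrow> nat" and z :: "complex ^ 'm"
    unfolding splitp by (simp add: up_def)
  have updn: "up (dn \<nu>) = \<nu>" if "\<nu> j \<noteq> 0" for \<nu> using that by (auto simp: up_def dn_def)
  have dnup: "dn (up \<nu>) = \<nu>" for \<nu> by (auto simp: up_def dn_def)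
  have "z $ j * P z = (\<Sum>\<nu> | (\<Sum>j\<in>UNIV. \<nu> j) = Suc d. b' \<nu> * (\<Prod>j\<in>UNIV. (z $ j) ^ \<nu> j))" for z
  proof -
    have "(\<Sum>\<nu> | (\<Sum>j\<in>UNIV. \<nu> j) = Suc d. b' \<nu> * (\<Prod>j\<in>UNIV. (z $ j) ^ \<nu> j))
        = (\<Sum>\<nu> | (\<Sum>j\<in>UNIV. \<nu> j) = Suc d \<and> \<nu> j \<noteq> 0. b' \<nu> * (\<Prod>j\<in>UNIV. (z $ j) ^ \<nu> j))"
      by (rule sum.mono_neutral_right[OF finite_multi_indices]) (auto simp: b'_def)
    also have "\<dots> = (\<Sum>\<nu> | (\<Sum>j\<in>UNIV. \<nu> j) = d. b' (up \<nu>) * (\<Prod>j\<in>UNIV. (z $ j) ^ up \<nu> j))"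
    proof (rule sum.reindex_bij_witness[where i = up and j = dn])
      fix \<nu> :: "'m \<Rightarrow> nat" assume \<nu>: "\<nu> \<in> {\<nu>. (\<Sum>j\<in>UNIV. \<nu> j) = Suc d \<and> \<nu> j \<noteq> 0}"
      thus "up (dn \<nu>) = \<nu>" using updn by simp
      thus "dn \<nu> \<in> {\<nu>. (\<Sum>j\<in>UNIV. \<nu> j) = d}" using \<nu> up_sum[of "dn \<nu>"] by simp
    next
      fix \<nu> :: "'m \<Rightarrow> nat" assume "\<nu> \<in> {\<nu>. (\<Sum>j\<in>UNIV. \<nu> j) = d}"
      thus "up \<nu> \<in> {\<nu>. (\<Sum>j\<in>UNIV. \<nu> j) = Suc d \<and> \<nu> j \<noteq> 0}" using up_sum by (simp add: up_def)
    qed (use updn dnup in auto)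
    also have "\<dots> = (\<Sum>\<nu> | (\<Sum>j\<in>UNIV. \<nu> j) = d. z $ j * (b \<nu> * (\<Prod>j\<in>UNIV. (z $ j) ^ \<nu> j)))"
      by (rule sum.cong[OF refl]) (simp add: up_prod b'_def dnup, simp add: up_def)
    finally show ?thesis by (simp add: b sum_distrib_left)
  qed
  thus ?thesis unfolding homogeneous_poly_def by blast
qed

lemma homogeneous_poly_smult:
  assumes "homogeneous_poly d P"
  shows "P (t *s z) = t ^ d * P z"
proof -
  obtain b where b: "\<And>z. P z = (\<Sum>\<nu> | (\<Sum>j\<in>UNIV. \<nu> j) = d. b \<nu> * (\<Prod>j\<in>UNIV. (z $ j) ^ \<nu> j))"
    using assms unfolding homogeneous_poly_def by blast
  show ?thesis unfolding b sum_distrib_left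
    by (rule sum.cong[OF refl]) (auto simp: power_mult_distrib prod.distrib simp flip: power_sum)
qed

text \<open>Induction on the order: \<open>\<partial>\<^sub>h f\<close> is the linear combination of the partial derivatives of \<open>f\<close> with
coefficients \<open>h\<^sub>j\<close>, and these are again entire.\<close>

lemma homogeneous_poly_dir_deriv_iter:
  fixes f :: "complex ^ 'm \<Rightarrow> complex"
  assumes "entire f"
  shows "homogeneous_poly i (\<lambda>h. (dir_deriv h ^^ i) f a)"
  using assms
proof (induction i arbitrary: f)
  case 0
  show ?case by (simp add: homogeneous_poly_const)
next
  case (Suc i)
  have "(dir_deriv h ^^ Suc i) f a = (\<Sum>j\<in>UNIV. h $ j * (dir_deriv h ^^ i) (partial_deriv j f) a)" for h
  proof -
    have "(dir_deriv h ^^ Suc i) f = (dir_deriv h ^^ i) (\<lambda>z. \<Sum>j\<in>UNIV. h $ j * partial_deriv j f z)"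
      by (simp only: funpow_Suc_right o_apply dir_deriv_def[abs_def])
    also have "\<dots> = (\<lambda>z. \<Sum>j\<in>UNIV. h $ j * (dir_deriv h ^^ i) (partial_deriv j f) z)"
      by (rule dir_deriv_iter_linear_combination) (auto intro: entire_partial_deriv Suc.prems)
    finally show ?thesis by simp
  qed
  thus ?case using Suc by (auto intro!: homogeneous_poly_sum homogeneous_poly_mult_coord entire_partial_deriv)
qed

text \<open>The Taylor series of \<open>t \<mapsto> f (a + t (z - a))\<close> at \<open>0\<close>, evaluated at \<open>t = 1\<close>.\<close>

lemma entire_homogeneous_expansion:
  assumes f: "entire f"
  shows "homogeneous_expansion f a (\<lambda>i h. (1 / fact i) * (dir_deriv h ^^ i) f a)"
  unfolding homogeneous_expansion_def
proof (intro conjI allI exI[of _ 1] ballI)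
  show "homogeneous_poly i (\<lambda>h. (1 / fact i) * (dir_deriv h ^^ i) f a)" for i
    by (intro homogeneous_poly_cmult homogeneous_poly_dir_deriv_iter f)
  fix z
  define \<phi> where "\<phi> t = f (a + t *s (z - a))" for t
  have "\<phi> holomorphic_on ball 0 2"
    using entire_line_holomorphic[OF f, of a "z - a"] unfolding \<phi>_def by (rule holomorphic_on_subset) auto
  hence "(\<lambda>n. (deriv ^^ n) \<phi> 0 / fact n * (1 - 0) ^ n) sums \<phi> 1"
    by (rule holomorphic_power_series) auto
  thus "(\<lambda>i. (1 / fact i) * (dir_deriv (z - a) ^^ i) f a) sums f z"
    unfolding \<phi>_def dir_deriv_iter_line[OF f] by simp
qed simp

lemma power_series_zero_coeffs:
  fixes c :: "nat \<Rightarrow> complex"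
  assumes "r > 0" and sums: "\<And>t. cmod t < r \<Longrightarrow> (\<lambda>i. c i * t ^ i) sums 0"
  shows "c m = 0"
proof (cases "m = 0")
  case True
  thus ?thesis using sums[of 0] \<open>r > 0\<close> by (simp add: sums_iff)
next
  case False
  show ?thesis
  proof (rule ccontr)
    assume "c m \<noteq> 0"
    moreover have "(\<lambda>i. c i * (x - 0) ^ i) sums (\<lambda>_. 0) x" if "cmod (x - 0) < r" for x
      using sums[of x] that by simp
    ultimately obtain s where s: "0 < s" "\<And>z. z \<in> cball (0::complex) s - {0} \<Longrightarrow> (0::complex) \<noteq> 0"
      using powser_0_nonzero[of r 0 c "\<lambda>_. 0" m] \<open>r > 0\<close> False by blast
    thus False using s(2)[of "of_real s"] by simp
  qed
qed

text \<open>By homogeneity the restriction to a line through \<open>a\<close> is a power series in one variable whose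
coefficients are the values \<open>P i h\<close>.\<close>

lemma homogeneous_expansion_unique:
  fixes g :: "complex ^ 'm \<Rightarrow> complex"
  assumes P: "homogeneous_expansion g a P" and Q: "homogeneous_expansion g a Q"
  shows "P = Q"
proof (intro ext)
  fix i and h :: "complex ^ 'm"
  obtain r1 where r1: "r1 > 0" "\<And>z. z \<in> ball a r1 \<Longrightarrow> (\<lambda>i. P i (z - a)) sums g z"
    using P by (auto simp: homogeneous_expansion_def)
  obtain r2 where r2: "r2 > 0" "\<And>z. z \<in> ball a r2 \<Longrightarrow> (\<lambda>i. Q i (z - a)) sums g z"
    using Q by (auto simp: homogeneous_expansion_def)
  have hP: "homogeneous_poly i (P i)" and hQ: "homogeneous_poly i (Q i)" for i
    using P Q by (auto simp: homogeneous_expansion_def)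
  define r where "r = min r1 r2"
  have "r > 0" using r1 r2 by (simp add: r_def)
  have "((\<lambda>t. t *s h) \<longlongrightarrow> 0 *s h) (at 0)"
    using bounded_linear.tendsto[OF bounded_linear_smult_vec tendsto_ident_at] .
  then obtain d where d: "d > 0" "\<And>t. t \<noteq> 0 \<Longrightarrow> cmod t < d \<Longrightarrow> norm (t *s h) < r"
    using \<open>r > 0\<close> by (auto simp: LIM_def dist_norm)
  have "P i h - Q i h = 0"
  proof (rule power_series_zero_coeffs[OF d(1), of "\<lambda>i. P i h - Q i h"])
    fix t :: complex assume "cmod t < d"
    hence "norm (t *s h) < r" using d \<open>r > 0\<close> by (cases "t = 0") auto
    hence "a + t *s h \<in> ball a r1 \<inter> ball a r2" by (auto simp: dist_norm r_def)
    hence "(\<lambda>i. P i (t *s h) - Q i (t *s h)) sums (g (a + t *s h) - g (a + t *s h))"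
      using r1(2)[of "a + t *s h"] r2(2)[of "a + t *s h"] by (intro sums_diff) auto
    thus "(\<lambda>i. (P i h - Q i h) * t ^ i) sums 0"
      by (simp add: homogeneous_poly_smult[OF hP] homogeneous_poly_smult[OF hQ] algebra_simps)
  qed
  thus "P i h = Q i h" by simp
qed

text \<open>The only term of the expansion that survives at \<open>a\<close> is the one of degree \<open>0\<close>.\<close>

lemma zero_mult_eq_0_iff:
  assumes g: "entire g"
  shows "min (zero_mult g a) 1 = 0 \<longleftrightarrow> g a \<noteq> 0"
proof -
  define P where "P = (\<lambda>i h. (1 / fact i) * (dir_deriv h ^^ i) g a)"
  have P: "homogeneous_expansion g a P" unfolding P_def by (rule entire_homogeneous_expansion[OF g])
  have P0: "P 0 z = g a" for z by (simp add: P_def)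
  have zm: "zero_mult g a = (INF i\<in>{i. \<exists>z. P i z \<noteq> 0}. enat i)"
    unfolding zero_mult_def
  proof (rule the_equality)
    show "\<exists>Pa. homogeneous_expansion g a Pa \<and>
      (INF i\<in>{i. \<exists>z. P i z \<noteq> 0}. enat i) = (INF i\<in>{i. \<exists>z. Pa i z \<noteq> 0}. enat i)" using P by blast
    fix d assume "\<exists>Pa. homogeneous_expansion g a Pa \<and> d = (INF i\<in>{i. \<exists>z. Pa i z \<noteq> 0}. enat i)"
    thus "d = (INF i\<in>{i. \<exists>z. P i z \<noteq> 0}. enat i)" using homogeneous_expansion_unique[OF P] by blast
  qed
  show ?thesis
  proof (cases "g a = 0")
    case True
    have "1 \<le> zero_mult g a" unfolding zm
    proof (rule INF_greatest)
      fix i assume "i \<in> {i. \<exists>z. P i z \<noteq> 0}"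
      hence "i \<noteq> 0" using P0 True by (cases i) auto
      thus "1 \<le> enat i" by (simp add: one_enat_def)
    qed
    thus ?thesis using True by (simp add: min_def)
  next
    case False
    have "zero_mult g a \<le> enat 0" unfolding zm by (rule INF_lower) (use P0 False in auto)
    thus ?thesis using False by (simp add: min_def zero_enat_def[symmetric])
  qed
qed

lemma share_IM_D:
  assumes "entire F" "entire G" "share_IM v F G"
  shows "F z = v \<longleftrightarrow> G z = v"
proof -
  have "min (zero_mult (\<lambda>w. F w - v) z) 1 = min (zero_mult (\<lambda>w. G w - v) z) 1"
    using assms(3) by (simp add: share_IM_def)
  thus ?thesis
    using zero_mult_eq_0_iff[OF entire_diff[OF assms(1) entire_const], of v z]
      zero_mult_eq_0_iff[OF entire_diff[OF assms(2) entire_const], of v z] by simp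
qed

text \<open>The line through a common point of non-vanishing for all but one function and such a point
for the last function reduces the induction step to one variable, where zero sets are countable.\<close>

lemma entire_common_nonzero_point:
  fixes G :: "'i \<Rightarrow> complex ^ 'm \<Rightarrow> complex"
  assumes "finite I" "\<And>i. i \<in> I \<Longrightarrow> entire (G i)" "\<And>i. i \<in> I \<Longrightarrow> \<exists>z. G i z \<noteq> 0"
  shows "\<exists>z. \<forall>i\<in>I. G i z \<noteq> 0"
  using assms
proof (induction I rule: finite_induct)
  case (insert i I)
  then obtain a where a: "\<forall>j\<in>I. G j a \<noteq> 0" by blast
  obtain b where b: "G i b \<noteq> 0" using insert by blast
  define H where "H j t = G j (a + t *s (b - a))" for j t
  have "\<exists>t. \<forall>j\<in>insert i I. H j t \<noteq> 0"
  proof (rule common_nonzero_point)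
    fix j assume j: "j \<in> insert i I"
    have "H j holomorphic_on UNIV" unfolding H_def
      by (rule entire_line_holomorphic) (use insert j in auto)
    moreover have "H j 0 \<noteq> 0 \<or> H j 1 \<noteq> 0" using a b j by (auto simp: H_def)
    ultimately show "H j holomorphic_on UNIV \<and> (\<exists>z. H j z \<noteq> 0)" by blast
  qed (use insert in auto)
  thus ?case unfolding H_def by blast
qed simp

section \<open>Back to several variables\<close>

definition drop_coord :: "'m \<Rightarrow> complex ^ 'm \<Rightarrow> complex ^ 'm" where
  "drop_coord j z = (\<chi> i. if i = j then 0 else z $ i)"

lemma entire_drop_coord:
  assumes f: "entire f"
  shows "entire (\<lambda>z. f (drop_coord j z))"
  unfolding entire_def
proof
  fix a
  have "linear (drop_coord j :: complex ^ 'a \<Rightarrow> _)"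
    by (rule linearI) (auto simp: drop_coord_def vec_eq_iff)
  hence bl: "bounded_linear (drop_coord j :: complex ^ 'a \<Rightarrow> _)" by (simp add: linear_conv_bounded_linear)
  have "(drop_coord j has_derivative drop_coord j) (at a)"
    by (rule bounded_linear.has_derivative[OF bl]) (auto intro!: derivative_eq_intros)
  from has_derivative_compose[OF this entire_has_derivative[OF f]]
  have "((\<lambda>z. f (drop_coord j z)) has_derivative
      (\<lambda>h. \<Sum>i\<in>UNIV. partial_deriv i f (drop_coord j a) * drop_coord j h $ i)) (at a)" .
  also have "(\<lambda>h. \<Sum>i\<in>UNIV. partial_deriv i f (drop_coord j a) * drop_coord j h $ i)
     = (\<lambda>h. \<Sum>i\<in>UNIV. (\<chi> i. if i = j then 0 else partial_deriv i f (drop_coord j a)) $ i * h $ i)"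
    by (auto simp: fun_eq_iff drop_coord_def intro!: sum.cong)
  finally show "\<exists>A. ((\<lambda>z. f (drop_coord j z)) has_derivative (\<lambda>h. \<Sum>i\<in>UNIV. A $ i * h $ i)) (at a)" by blast
qed

lemma indep_drop_coord: "indep_of_coord j (\<lambda>z. f (drop_coord j z))"
  unfolding indep_of_coord_def
proof (intro allI impI)
  fix z w :: "complex ^ 'a" assume "\<forall>i. i \<noteq> j \<longrightarrow> z $ i = w $ i"
  hence "drop_coord j z = drop_coord j w" by (simp add: drop_coord_def vec_eq_iff)
  thus "f (drop_coord j z) = f (drop_coord j w)" by simp
qed

text \<open>A continuous logarithm exists because the space is contractible.  Near \<open>a\<close> it differs from the
principal logarithm of \<open>\<beta> z / \<beta> a\<close> by a constant, and so it is differentiable.\<close>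

lemma entire_logarithm:
  fixes \<beta> :: "complex ^ 'm \<Rightarrow> complex"
  assumes \<beta>: "entire \<beta>" and nz: "\<And>z. \<beta> z \<noteq> 0"
  obtains \<alpha> where "entire \<alpha>" "\<And>z. exp (\<alpha> z) = \<beta> z"
proof -
  obtain \<alpha> where c: "continuous_on UNIV \<alpha>" and e: "\<And>z. \<beta> z = exp (\<alpha> z)"
    using continuous_logarithm_on_contractible[OF entire_continuous[OF \<beta>, of UNIV] convex_imp_contractible[OF convex_UNIV]] nz
    by (metis UNIV_I)
  have "entire \<alpha>" unfolding entire_def
  proof
    fix a
    have "((\<lambda>z. \<beta> z * (1 / \<beta> a)) has_derivative (\<lambda>h. (\<Sum>j\<in>UNIV. partial_deriv j \<beta> a * h $ j) * (1 / \<beta> a))) (at a)"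
      by (intro has_derivative_mult_left entire_has_derivative \<beta>)
    moreover have "(Ln has_derivative (*) 1) (at (\<beta> a * (1 / \<beta> a)))"
      using has_field_derivative_Ln[of 1] nz[of a] by (simp add: has_field_derivative_def)
    ultimately have "((\<lambda>z. Ln (\<beta> z * (1 / \<beta> a))) has_derivative
        (\<lambda>h. 1 * ((\<Sum>j\<in>UNIV. partial_deriv j \<beta> a * h $ j) * (1 / \<beta> a)))) (at a)"
      by (rule has_derivative_compose)
    hence "((\<lambda>z. \<alpha> a + Ln (\<beta> z * (1 / \<beta> a))) has_derivative
        (\<lambda>h. 0 + 1 * ((\<Sum>j\<in>UNIV. partial_deriv j \<beta> a * h $ j) * (1 / \<beta> a)))) (at a)"
      by (intro has_derivative_add has_derivative_const)
    also have "(\<lambda>h. 0 + 1 * ((\<Sum>j\<in>UNIV. partial_deriv j \<beta> a * h $ j) * (1 / \<beta> a)))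
        = (\<lambda>h. \<Sum>j\<in>UNIV. (\<chi> j. partial_deriv j \<beta> a / \<beta> a) $ j * h $ j)"
      by (simp add: fun_eq_iff sum_divide_distrib)
    finally have d: "((\<lambda>z. \<alpha> a + Ln (\<beta> z * (1 / \<beta> a))) has_derivative
        (\<lambda>h. \<Sum>j\<in>UNIV. (\<chi> j. partial_deriv j \<beta> a / \<beta> a) $ j * h $ j)) (at a)" .
    let ?S = "{z. cmod (\<alpha> z - \<alpha> a) < pi}"
    have op: "open ?S" by (intro open_Collect_less continuous_intros c)
    have aS: "a \<in> ?S" by simp
    have "\<alpha> a + Ln (\<beta> z * (1 / \<beta> a)) = \<alpha> z" if z: "z \<in> ?S" for z
    proof -
      have "\<bar>Im (\<alpha> z - \<alpha> a)\<bar> < pi" using z abs_Im_le_cmod[of "\<alpha> z - \<alpha> a"] by simp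
      hence "Ln (exp (\<alpha> z - \<alpha> a)) = \<alpha> z - \<alpha> a" by (intro Ln_exp) auto
      moreover have "\<beta> z * (1 / \<beta> a) = exp (\<alpha> z - \<alpha> a)" by (simp add: e exp_diff)
      ultimately show ?thesis by simp
    qed
    with has_derivative_transform_within_open[OF d op aS]
    have "(\<alpha> has_derivative (\<lambda>h. \<Sum>j\<in>UNIV. (\<chi> j. partial_deriv j \<beta> a / \<beta> a) $ j * h $ j)) (at a)" by blast
    thus "\<exists>A. (\<alpha> has_derivative (\<lambda>h. \<Sum>j\<in>UNIV. A $ j * h $ j)) (at a)" by blast
  qed
  thus thesis using that e by metis
qed

text \<open>On a line in direction \<open>u\<close> the equation is \<open>y' = y / c\<close>.\<close>

lemma dir_deriv_eigenfunction:
  assumes f: "entire f" and c: "c \<noteq> 0" and eq: "\<And>z. f z = c * dir_deriv u f z"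
  shows "f (z + t *s u) = exp (t / c) * f z"
proof -
  define \<phi> where "\<phi> t = exp (- t / c) * f (z + t *s u)" for t
  have "(\<phi> has_field_derivative 0) (at t)" for t
  proof -
    have "((\<lambda>t. exp (- t / c)) has_field_derivative - (1 / c) * exp (- t / c)) (at t)"
      using c by (auto intro!: derivative_eq_intros simp: field_simps)
    from DERIV_mult[OF this entire_line_DERIV[OF f, of z u t]]
    have "(\<phi> has_field_derivative - (1 / c) * exp (- t / c) * f (z + t *s u) + dir_deriv u f (z + t *s u) * exp (- t / c)) (at t)"
      unfolding \<phi>_def .
    also have "- (1 / c) * exp (- t / c) * f (z + t *s u) + dir_deriv u f (z + t *s u) * exp (- t / c) = 0"
      using eq[of "z + t *s u"] c by (simp add: field_simps)
    finally show ?thesis .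
  qed
  then obtain b where "\<And>t. \<phi> t = b"
    using has_field_derivative_zero_constant[of UNIV \<phi>] by auto
  hence "\<phi> t = \<phi> 0" by simp
  hence "exp (t / c) * (exp (- t / c) * f (z + t *s u)) = exp (t / c) * f z" by (simp add: \<phi>_def)
  thus ?thesis by (simp add: mult.assoc[symmetric] flip: exp_add)
qed

text \<open>The one-variable theorem gives on each line some \<open>c\<close>, a priori depending on the line, or says nothing
because \<open>\<partial>\<^sub>u\<^sup>k (f\<^sup>n)\<close> vanishes there.  As \<open>c\<close> ranges over a finite set, the absence of
zero divisors among entire functions makes it uniform.\<close>

lemma dir_deriv_eigenvalue:
  fixes u :: "complex ^ 'm"
  assumes f: "entire f" and k: "k > 0" and kn: "n \<ge> k + 2"
    and nz: "\<exists>z. (dir_deriv u ^^ k) (\<lambda>w. f w ^ n) z \<noteq> 0"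
    and share: "\<And>z. f z ^ n = 1 \<Longrightarrow> (dir_deriv u ^^ k) (\<lambda>w. f w ^ n) z = 1"
  shows "\<exists>c. c \<noteq> 0 \<and> (c / of_nat n) ^ k = 1 \<and> (\<forall>z. f z = c * dir_deriv u f z)"
proof -
  have fn: "entire (\<lambda>w. f w ^ n)" by (rule entire_power[OF f])
  \<comment> \<open>One function for each alternative; at every point at least one of them vanishes.\<close>
  define G where "G i = (case i of None \<Rightarrow> (dir_deriv u ^^ k) (\<lambda>w. f w ^ n) | Some c \<Rightarrow> (\<lambda>z. f z - c * dir_deriv u f z))" for i
  define C where "C = {c :: complex. (c / of_nat n) ^ k = 1}"
  have "C = (\<lambda>x. of_nat n * x) ` {x. x ^ k = 1}"
  proof (intro equalityI subsetI)
    fix c assume "c \<in> C"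
    thus "c \<in> (\<lambda>x. of_nat n * x) ` {x. x ^ k = 1}"
      using kn by (intro image_eqI[of _ _ "c / of_nat n"]) (auto simp: C_def)
  qed (use kn in \<open>auto simp: C_def\<close>)
  hence finC: "finite C" using finite_roots_unity[of k, where 'a = complex] k by simp
  have line: "\<exists>i\<in>insert None (Some ` C). G i z = 0" for z
  proof (cases "(dir_deriv u ^^ k) (\<lambda>w. f w ^ n) z = 0")
    case True
    thus ?thesis by (simp add: G_def)
  next
    case False
    define g where "g t = f (z + t *s u)" for t
    have d: "(deriv ^^ k) (\<lambda>t. g t ^ n) t = (dir_deriv u ^^ k) (\<lambda>w. f w ^ n) (z + t *s u)" for t
      unfolding g_def using dir_deriv_iter_line[OF fn, of k z u] by simp
    have "\<exists>c. c \<noteq> 0 \<and> (c / of_nat n) ^ k = 1 \<and> (\<forall>t. g t = c * deriv g t)"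
    proof (rule power_sharing_one_variable[OF _ k kn])
      show "g holomorphic_on UNIV" unfolding g_def by (rule entire_line_holomorphic[OF f])
      show "\<exists>t. (deriv ^^ k) (\<lambda>t. g t ^ n) t \<noteq> 0" using False by (intro exI[of _ 0]) (simp add: d)
      show "(deriv ^^ k) (\<lambda>t. g t ^ n) t = 1" if "g t ^ n = 1" for t
        using share that by (simp add: d) (simp add: g_def)
    qed
    then obtain c where c: "c \<in> C" "g 0 = c * deriv g 0" by (auto simp: C_def)
    have "deriv g 0 = dir_deriv u f (z + 0 *s u)"
      unfolding g_def by (rule DERIV_imp_deriv[OF entire_line_DERIV[OF f]])
    hence "G (Some c) z = 0" using c by (simp add: G_def g_def)
    thus ?thesis using c by blast
  qed
  have Ge: "entire (G i)" for i
    by (cases i) (auto simp: G_def intro!: entire_dir_deriv_iter fn entire_diff f entire_cmult entire_dir_deriv)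
  have "\<exists>i\<in>insert None (Some ` C). \<forall>z. G i z = 0"
  proof (rule ccontr)
    assume "\<not> ?thesis"
    hence "\<exists>z. \<forall>i\<in>insert None (Some ` C). G i z \<noteq> 0"
      using finC Ge by (intro entire_common_nonzero_point) auto
    thus False using line by blast
  qed
  moreover have "\<not> (\<forall>z. G None z = 0)" using nz by (simp add: G_def)
  ultimately obtain c where c: "c \<in> C" "\<forall>z. G (Some c) z = 0" by blast
  moreover have "c \<noteq> 0" using c k by (auto simp: C_def power_0_left)
  ultimately show ?thesis by (intro exI[of _ c]) (auto simp: C_def G_def)
qed

text \<open>In the coordinate case \<open>z = drop_coord j z + z\<^sub>j u\<close>, so \<open>f z = exp (z\<^sub>j / c) f (drop_coord j z)\<close>.
A logarithm \<open>\<alpha>\<close> of \<open>f\<close> on the whole space, composed with \<open>drop_coord j\<close>, is automatically independent of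
\<open>z\<^sub>j\<close>.\<close>

theorem theorem2p2:
  fixes u :: "complex ^ 'm" and f :: "complex ^ 'm \<Rightarrow> complex" and k n :: nat
  assumes "(\<Sum>j\<in>UNIV. (cmod (u $ j))\<^sup>2) = 1"
    and "entire f" and "\<not> f constant_on UNIV"
    and "k > 0" and "n > 0" and "n \<ge> k + 2"
    and "\<exists>z. (dir_deriv u ^^ k) (\<lambda>w. f w ^ n) z \<noteq> 0"
    and "share_IM 1 (\<lambda>w. f w ^ n) ((dir_deriv u ^^ k) (\<lambda>w. f w ^ n))"
  shows "\<exists>c :: complex. c \<noteq> 0 \<and> (c / of_nat n) ^ k = 1 \<and>
    (\<forall>z. f z = c * dir_deriv u f z) \<and>
    (\<forall>j. u $ j = 1 \<and> (\<forall>i. i \<noteq> j \<longrightarrow> u $ i = 0) \<longrightarrow>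
       (\<exists>\<beta>. entire \<beta> \<and> indep_of_coord j \<beta> \<and> (\<forall>z. f z = exp (z $ j / c) * \<beta> z)) \<and>
       ((\<forall>z. f z \<noteq> 0) \<longrightarrow>
          (\<exists>\<alpha>. entire \<alpha> \<and> indep_of_coord j \<alpha> \<and> (\<forall>z. f z = exp (z $ j / c + \<alpha> z)) \<and>
               ((\<exists>z w. z $ j = w $ j \<and> f z \<noteq> f w) \<longrightarrow> \<not> \<alpha> constant_on UNIV))))"
proof -
  note f = \<open>entire f\<close>
  have fn: "entire (\<lambda>w. f w ^ n)" by (rule entire_power[OF f])
  have "(dir_deriv u ^^ k) (\<lambda>w. f w ^ n) z = 1" if "f z ^ n = 1" for z
    using share_IM_D[OF fn entire_dir_deriv_iter[OF fn] assms(8)] that by blast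
  then obtain c where c: "c \<noteq> 0" "(c / of_nat n) ^ k = 1" "\<And>z. f z = c * dir_deriv u f z"
    using dir_deriv_eigenvalue[OF f assms(4,6,7)] by blast
  have "(\<exists>\<beta>. entire \<beta> \<and> indep_of_coord j \<beta> \<and> (\<forall>z. f z = exp (z $ j / c) * \<beta> z)) \<and>
       ((\<forall>z. f z \<noteq> 0) \<longrightarrow>
          (\<exists>\<alpha>. entire \<alpha> \<and> indep_of_coord j \<alpha> \<and> (\<forall>z. f z = exp (z $ j / c + \<alpha> z)) \<and>
               ((\<exists>z w. z $ j = w $ j \<and> f z \<noteq> f w) \<longrightarrow> \<not> \<alpha> constant_on UNIV)))"
    if u: "u $ j = 1 \<and> (\<forall>i. i \<noteq> j \<longrightarrow> u $ i = 0)" for j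
  proof (intro conjI impI)
    have fz: "f z = exp (z $ j / c) * f (drop_coord j z)" for z
    proof -
      have "z = drop_coord j z + (z $ j) *s u" using u by (auto simp: vec_eq_iff drop_coord_def)
      thus ?thesis using dir_deriv_eigenfunction[OF f c(1,3), of "drop_coord j z" "z $ j"] by simp
    qed
    thus "\<exists>\<beta>. entire \<beta> \<and> indep_of_coord j \<beta> \<and> (\<forall>z. f z = exp (z $ j / c) * \<beta> z)"
      using entire_drop_coord[OF f] indep_drop_coord by blast
    assume "\<forall>z. f z \<noteq> 0"
    then obtain \<alpha> where \<alpha>: "entire \<alpha>" "\<And>z. exp (\<alpha> z) = f z" using entire_logarithm[OF f] by metis
    define \<alpha>' where "\<alpha>' z = \<alpha> (drop_coord j z)" for z
    have fe: "f z = exp (z $ j / c + \<alpha>' z)" for z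
      unfolding exp_add \<alpha>'_def \<alpha>(2) by (rule fz)
    have "\<not> \<alpha>' constant_on UNIV" if "\<exists>z w. z $ j = w $ j \<and> f z \<noteq> f w"
    proof
      assume "\<alpha>' constant_on UNIV"
      then obtain b where "\<And>z. \<alpha>' z = b" by (auto simp: constant_on_def)
      hence "f z = exp (z $ j / c + b)" for z using fe by simp
      thus False using that by auto
    qed
    moreover have "entire \<alpha>'" "indep_of_coord j \<alpha>'"
      unfolding \<alpha>'_def by (rule entire_drop_coord[OF \<alpha>(1)], rule indep_drop_coord)
    ultimately show "\<exists>\<alpha>. entire \<alpha> \<and> indep_of_coord j \<alpha> \<and> (\<forall>z. f z = exp (z $ j / c + \<alpha> z)) \<and>
               ((\<exists>z w. z $ j = w $ j \<and> f z \<noteq> f w) \<longrightarrow> \<not> \<alpha> constant_on UNIV)"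
      using fe by blast
  qed
  thus ?thesis using c by blast
qed


end
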